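(* Let $W$ be the Coxeter group associated to a non-affine irreducible Coxeter matrix. Then the amenable radical of $W$ is trivial: $R(W)=\{1\}$.
   Context: Let $S$ be a set (possibly infinite) and $M=(m_{st})_{(s,t)\in S^2}$ a symmetric matrix with $1$'s on the diagonal and off-diagonal coefficients in $\{2,3,\dots,\infty\}$ (a Coxeter matrix). The associated Coxeter group is $W=\langle (\sigma_s)_{s\in S}\mid ((\sigma_s\sigma_t)^{m_{st}})_{(s,t)\in S^2}\rangle$, with the convention $x^\infty=1$. The Coxeter graph has vertex set $S$ and an edge between $s$ and $t$ if and only if $m_{st}\ge 3$. The matrix $M$ (and by abuse of language $W$) is irreducible if this graph is connected and non-empty. An irreducible Coxeter group is of spherical type if it is locally finite (finite diagrams $A_n$, $B_n$, $D_n$, $E_6,E_7,E_8$, $F_4$, $H_3$, $H_4$, $I_2(n)$, and infinite diagrams $A_\infty$, $A'_\infty$, $B_\infty$, $D_\infty$). It is of affine type if its diagram is one of $\widetilde{A_n}$ ($n\ge1$), $\widetilde{B_n}$ ($n\ge 3$), $\widetilde{C_n}$ ($n\ge2$), $\widetilde{D_n}$ ($n\ge4$), $\widetilde{E_n}$ ($6\le n\le 8$), $\widetilde{F_4}$, $\widetilde{G_2}$; equivalently, $S$ is finite and the Tits form, i.e. the symmetric bilinear form $B$ on $\mathbf{R}^{(S)}$ with basis $(e_s)_{s\in S}$ given by $B(e_s,e_t)=-\cos(\pi/m_{st})$, is positive semidefinite with one-dimensional kernel. "Non-affine" means irreducible and neither of spherical type nor of affine type. The amenable radical $R(\Gamma)$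 of a discrete group $\Gamma$ is its unique largest amenable normal subgroup. *)

theory Defs
  imports "HOL-Analysis.Analysis" "HOL-Algebra.Algebra" "HOL-Library.Extended_Nat"
begin

section \<open>Groups given by generators and relators\<close>

text \<open>The letter \<open>(s, True)\<close> stands for the generator \<open>s\<close>, and \<open>(s, False)\<close> for its formal inverse.\<close>

type_synonym 's word = "('s \<times> bool) list"

definition words :: "'s set \<Rightarrow> 's word set"
  where "words S = lists (S \<times> UNIV)"

text \<open>Two words are related iff they define the same element of the group presented
  by the generators \<open>S\<close> and the relators \<open>R\<close>.\<close>

inductive_set pres_rel :: "'s set \<Rightarrow> 's word set \<Rightarrow> ('s word \<times> 's word) set"
  for S :: "'s set" and R :: "'s word set"
where
  refl: "w \<in> words S \<Longrightarrow> (w, w) \<in> pres_rel S R"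
| sym: "(v, w) \<in> pres_rel S R \<Longrightarrow> (w, v) \<in> pres_rel S R"
| trans: "(u, v) \<in> pres_rel S R \<Longrightarrow> (v, w) \<in> pres_rel S R \<Longrightarrow> (u, w) \<in> pres_rel S R"
| append: "(u, u') \<in> pres_rel S R \<Longrightarrow> (v, v') \<in> pres_rel S R \<Longrightarrow> (u @ v, u' @ v') \<in> pres_rel S R"
| cancel: "s \<in> S \<Longrightarrow> ([(s, b), (s, \<not> b)], []) \<in> pres_rel S R"
| relator: "r \<in> R \<Longrightarrow> r \<in> words S \<Longrightarrow> (r, []) \<in> pres_rel S R"

definition presented_group :: "'s set \<Rightarrow> 's word set \<Rightarrow> 's word set monoid"
  where "presented_group S R =
    \<lparr>carrier = words S // pres_rel S R,
     mult = (\<lambda>A B. \<Union>u\<in>A. \<Union>v\<in>B. pres_rel S R `` {u @ v}),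
     one = pres_rel S R `` {[]}\<rparr>"

lemma pres_rel_words: "(u, v) \<in> pres_rel S R \<Longrightarrow> u \<in> words S \<and> v \<in> words S"
  by (induction rule: pres_rel.induct) (auto simp: words_def)

lemma equiv_pres_rel: "equiv (words S) (pres_rel S R)"
proof (rule equivI)
  show "pres_rel S R \<subseteq> words S \<times> words S"
    using pres_rel_words by fastforce
  show "refl_on (words S) (pres_rel S R)"
    by (auto simp: refl_on_def pres_rel.refl)
  show "sym (pres_rel S R)"
    by (rule symI) (rule pres_rel.sym)
  show "trans (pres_rel S R)"
    by (rule transI) (rule pres_rel.trans)
qed

lemma presented_group_mult:
  assumes "u \<in> words S" "v \<in> words S"
  shows "pres_rel S R `` {u} \<otimes>\<^bsub>presented_group S R\<^esub> pres_rel S R `` {v} = pres_rel S R `` {u @ v}"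
proof -
  have eq: "pres_rel S R `` {u' @ v'} = pres_rel S R `` {u @ v}"
    if "(u, u') \<in> pres_rel S R" "(v, v') \<in> pres_rel S R" for u' v'
    using equiv_class_eq[OF equiv_pres_rel pres_rel.append[OF that]] by simp
  have "(u, u) \<in> pres_rel S R" "(v, v) \<in> pres_rel S R"
    using assms by (auto intro: pres_rel.refl)
  then have "(\<Union>u'\<in>pres_rel S R `` {u}. \<Union>v'\<in>pres_rel S R `` {v}. pres_rel S R `` {u' @ v'})
      = pres_rel S R `` {u @ v}"
    using eq by blast
  then show ?thesis
    by (simp add: presented_group_def)
qed

lemma inverse_word_pres_rel:
  assumes "w \<in> words S"
  shows "(rev (map (\<lambda>(s, b). (s, \<not> b)) w) @ w, []) \<in> pres_rel S R"
  using assms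
proof (induction w)
  case Nil
  then show ?case by (auto intro: pres_rel.refl simp: words_def)
next
  case (Cons a w)
  obtain s b where a: "a = (s, b)" by (cases a)
  let ?i = "rev (map (\<lambda>(s, b). (s, \<not> b)) w)"
  have w: "w \<in> words S" and s: "s \<in> S"
    using Cons.prems a by (auto simp: words_def)
  have i: "?i \<in> words S"
    using w by (auto simp: words_def)
  have "([(s, \<not> b), (s, b)], []) \<in> pres_rel S R"
    using pres_rel.cancel[OF s, of "\<not> b"] by simp
  from pres_rel.append[OF this pres_rel.refl[OF w]]
  have "(([(s, \<not> b), (s, b)] @ w), w) \<in> pres_rel S R" by simp
  from pres_rel.append[OF pres_rel.refl[OF i] this]
  have "(?i @ [(s, \<not> b), (s, b)] @ w, ?i @ w) \<in> pres_rel S R" .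
  then show ?case
    using pres_rel.trans[OF _ Cons.IH[OF w]] a by simp
qed

theorem group_presented_group: "group (presented_group S R)"
proof -
  let ?G = "presented_group S R"
  let ?c = "\<lambda>w. pres_rel S R `` {w}"
  have carr: "carrier ?G = words S // pres_rel S R" and one: "\<one>\<^bsub>?G\<^esub> = ?c []"
    by (auto simp: presented_group_def)
  have in_carr: "?c w \<in> carrier ?G" if "w \<in> words S" for w
    unfolding carr using that by (rule quotientI)
  have rep: "\<exists>w\<in>words S. x = ?c w" if "x \<in> carrier ?G" for x
    using that unfolding carr by (auto elim: quotientE)
  have app: "u @ v \<in> words S" if "u \<in> words S" "v \<in> words S" for u v :: "'a word"
    using that by (auto simp: words_def)
  have nil: "[] \<in> words S" by (simp add: words_def)
  show ?thesis
  proof (rule groupI)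
    fix x y assume "x \<in> carrier ?G" "y \<in> carrier ?G"
    then obtain u v where "u \<in> words S" "v \<in> words S" "x = ?c u" "y = ?c v"
      using rep by meson
    then show "x \<otimes>\<^bsub>?G\<^esub> y \<in> carrier ?G"
      by (simp add: presented_group_mult app in_carr)
  next
    show "\<one>\<^bsub>?G\<^esub> \<in> carrier ?G"
      unfolding one by (rule in_carr[OF nil])
  next
    fix x y z assume "x \<in> carrier ?G" "y \<in> carrier ?G" "z \<in> carrier ?G"
    then obtain u v w where "u \<in> words S" "v \<in> words S" "w \<in> words S"
      "x = ?c u" "y = ?c v" "z = ?c w"
      using rep by meson
    then show "x \<otimes>\<^bsub>?G\<^esub> y \<otimes>\<^bsub>?G\<^esub> z = x \<otimes>\<^bsub>?G\<^esub> (y \<otimes>\<^bsub>?G\<^esub> z)"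
      by (simp add: presented_group_mult app)
  next
    fix x assume "x \<in> carrier ?G"
    then obtain u where "u \<in> words S" "x = ?c u"
      using rep by meson
    then show "\<one>\<^bsub>?G\<^esub> \<otimes>\<^bsub>?G\<^esub> x = x"
      using presented_group_mult[OF nil] by (simp add: one)
  next
    fix x assume "x \<in> carrier ?G"
    then obtain u where u: "u \<in> words S" "x = ?c u"
      using rep by meson
    let ?i = "rev (map (\<lambda>(s, b). (s, \<not> b)) u)"
    have i: "?i \<in> words S"
      using u by (auto simp: words_def)
    have "?c ?i \<otimes>\<^bsub>?G\<^esub> x = ?c (?i @ u)"
      using presented_group_mult[OF i u(1)] u(2) by simp
    also have "\<dots> = \<one>\<^bsub>?G\<^esub>"
      using equiv_class_eq[OF equiv_pres_rel inverse_word_pres_rel[OF u(1)]] one by simp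
    finally show "\<exists>y\<in>carrier ?G. y \<otimes>\<^bsub>?G\<^esub> x = \<one>\<^bsub>?G\<^esub>"
      using in_carr[OF i] by blast
  qed
qed

section \<open>Coxeter groups\<close>

definition coxeter_matrix :: "'s set \<Rightarrow> ('s \<Rightarrow> 's \<Rightarrow> enat) \<Rightarrow> bool"
  where "coxeter_matrix S m \<longleftrightarrow>
    (\<forall>s\<in>S. \<forall>t\<in>S. m s t = m t s) \<and>
    (\<forall>s\<in>S. m s s = 1) \<and>
    (\<forall>s\<in>S. \<forall>t\<in>S. s \<noteq> t \<longrightarrow> 2 \<le> m s t)"

text \<open>An infinite coefficient contributes no relator.\<close>

definition coxeter_relators :: "'s set \<Rightarrow> ('s \<Rightarrow> 's \<Rightarrow> enat) \<Rightarrow> 's word set"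
  where "coxeter_relators S m =
    {concat (replicate n [(s, True), (t, True)]) | s t n. s \<in> S \<and> t \<in> S \<and> m s t = enat n}"

definition coxeter_group :: "'s set \<Rightarrow> ('s \<Rightarrow> 's \<Rightarrow> enat) \<Rightarrow> 's word set monoid"
  where "coxeter_group S m = presented_group S (coxeter_relators S m)"

definition coxeter_graph :: "'s set \<Rightarrow> ('s \<Rightarrow> 's \<Rightarrow> enat) \<Rightarrow> ('s \<times> 's) set"
  where "coxeter_graph S m = {(s, t). s \<in> S \<and> t \<in> S \<and> 3 \<le> m s t}"

definition irreducible_coxeter :: "'s set \<Rightarrow> ('s \<Rightarrow> 's \<Rightarrow> enat) \<Rightarrow> bool"
  where "irreducible_coxeter S m \<longleftrightarrow>
    S \<noteq> {} \<and> (\<forall>s\<in>S. \<forall>t\<in>S. (s, t) \<in> (coxeter_graph S m)\<^sup>*)"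

definition locally_finite_group :: "('a, 'b) monoid_scheme \<Rightarrow> bool"
  where "locally_finite_group G \<longleftrightarrow>
    (\<forall>A. A \<subseteq> carrier G \<and> finite A \<longrightarrow> finite (generate G A))"

definition spherical_type :: "'s set \<Rightarrow> ('s \<Rightarrow> 's \<Rightarrow> enat) \<Rightarrow> bool"
  where "spherical_type S m \<longleftrightarrow>
    irreducible_coxeter S m \<and> locally_finite_group (coxeter_group S m)"

text \<open>The elements of \<open>\<real>\<^sup>(\<^sup>S\<^sup>)\<close> are the finitely supported functions vanishing off \<open>S\<close>.\<close>

definition tits_space :: "'s set \<Rightarrow> ('s \<Rightarrow> real) set"
  where "tits_space S = {x. finite {s. x s \<noteq> 0} \<and> {s. x s \<noteq> 0} \<subseteq> S}"

text \<open>The value at \<open>\<infinity>\<close> is \<open>- cos 0\<close>, with the convention \<open>\<pi> / \<infinity> = 0\<close>.\<close>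

definition tits_coeff :: "('s \<Rightarrow> 's \<Rightarrow> enat) \<Rightarrow> 's \<Rightarrow> 's \<Rightarrow> real"
  where "tits_coeff m s t = (case m s t of enat n \<Rightarrow> - cos (pi / real n) | \<infinity> \<Rightarrow> - 1)"

definition tits_form :: "('s \<Rightarrow> 's \<Rightarrow> enat) \<Rightarrow> ('s \<Rightarrow> real) \<Rightarrow> ('s \<Rightarrow> real) \<Rightarrow> real"
  where "tits_form m x y =
    (\<Sum>s | x s \<noteq> 0. \<Sum>t | y t \<noteq> 0. x s * y t * tits_coeff m s t)"

definition tits_kernel :: "'s set \<Rightarrow> ('s \<Rightarrow> 's \<Rightarrow> enat) \<Rightarrow> ('s \<Rightarrow> real) set"
  where "tits_kernel S m = {x \<in> tits_space S. \<forall>y\<in>tits_space S. tits_form m x y = 0}"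

text \<open>The last conjunct says that the kernel of the form is one-dimensional.\<close>

definition affine_type :: "'s set \<Rightarrow> ('s \<Rightarrow> 's \<Rightarrow> enat) \<Rightarrow> bool"
  where "affine_type S m \<longleftrightarrow>
    irreducible_coxeter S m \<and> finite S \<and>
    (\<forall>x\<in>tits_space S. 0 \<le> tits_form m x x) \<and>
    (\<exists>v. v \<noteq> (\<lambda>_. 0) \<and> tits_kernel S m = {(\<lambda>s. c * v s) | c. True})"

definition non_affine :: "'s set \<Rightarrow> ('s \<Rightarrow> 's \<Rightarrow> enat) \<Rightarrow> bool"
  where "non_affine S m \<longleftrightarrow>
    irreducible_coxeter S m \<and> \<not> spherical_type S m \<and> \<not> affine_type S m"

section \<open>The amenable radical\<close>

text \<open>Amenability of a discrete group: there is a left-invariant finitely additive probability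
  measure defined on all subsets.\<close>

definition amenable_group :: "('a, 'b) monoid_scheme \<Rightarrow> bool"
  where "amenable_group G \<longleftrightarrow> group G \<and>
    (\<exists>\<mu> :: 'a set \<Rightarrow> real.
      (\<forall>A. A \<subseteq> carrier G \<longrightarrow> 0 \<le> \<mu> A) \<and>
      \<mu> (carrier G) = 1 \<and>
      (\<forall>A B. A \<subseteq> carrier G \<and> B \<subseteq> carrier G \<and> A \<inter> B = {} \<longrightarrow> \<mu> (A \<union> B) = \<mu> A + \<mu> B) \<and>
      (\<forall>g A. g \<in> carrier G \<and> A \<subseteq> carrier G \<longrightarrow> \<mu> (g <#\<^bsub>G\<^esub> A) = \<mu> A))"

text \<open>The order on sets is inclusion.\<close>

definition amenable_radical :: "('a, 'b) monoid_scheme \<Rightarrow> 'a set"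
  where "amenable_radical G = (GREATEST N. N \<lhd> G \<and> amenable_group (G\<lparr>carrier := N\<rparr>))"

end

theory Submission
  imports Defs
begin

text \<open>A root \<open>x\<close> cuts the group into the half-space of the \<open>w\<close> with \<open>w\<^sup>-\<^sup>1 x\<close> positive and its
  complement. An invariant mean on a normal subgroup \<open>N\<close> gives every half-space a mass, constant
  on \<open>N\<close>-orbits of roots. If \<open>B x y \<le> -1\<close>, the half-spaces of \<open>x, y\<close> or those of \<open>-x, -y\<close> are
  disjoint, since only finitely many walls separate two elements. Now suppose that the
  group is non-affine and \<open>N\<close> is nontrivial. Some root \<open>d\<close> and \<open>n \<in> N\<close> satisfy
  \<open>B d (n d) \<le> -1\<close>; as \<open>N\<close> is normalised by the reflection in \<open>d\<close>, this happens on both sides, and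
  all half-spaces in the orbit of \<open>d\<close> have mass \<open>1 / 2\<close>. But the orbit contains, up to sign,
  three roots with pairwise products at most \<open>-1\<close>, hence three disjoint half-spaces. Both facts
  about roots rest on the unboundedness of the form on orbits of roots: otherwise it would be
  bounded on the orbit of an eigenvector of negative eigenvalue.\<close>

section \<open>Finitely supported vectors\<close>

text \<open>The form takes the same value on \<open>x, y\<close> and on \<open>- x, - y\<close>, so
  it cannot tell which of the two pairs of half-spaces is disjoint; hence both signs are carried
  along. \<open>non_affine\<close> denies local finiteness and the affine shape of the form, and a
  negative value has to be extracted from this. As \<open>S\<close> may be infinite, the eigenvector
  in use lives on a finite subset. If \<open>B x y > 1\<close>, the product of the two reflections
  stretches an isotropic vector \<open>v\<close>, shrinks another one, \<open>w\<close>, and fixes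
  what is orthogonal to both. Since \<open>B v w > 0\<close>, the ends of the axis of this
  translation are \<open>v\<close> and \<open>- w\<close>, and \<open>B v z * B w z < 0\<close> says
  that the wall of \<open>z\<close> leaves both ends on one side. Such a root is used twice: a high
  power of the translation moves its wall off itself, and it is the third member of the triple,
  beside two walls pushed towards the ends.\<close>

typedef 's fvec = "{f :: 's \<Rightarrow> real. finite {s. f s \<noteq> 0}}" morphisms coef Abs_fvec
  by (rule exI[of _ "\<lambda>_. 0"]) simp

lemma finite_supp [simp]: "finite {s. coef x s \<noteq> 0}"
  using coef[of x] by simp

lemma fvec_eqI: "(\<And>s. coef x s = coef y s) \<Longrightarrow> x = y"
  by (simp add: coef_inject[symmetric] fun_eq_iff)

lemma coef_Abs: "finite {s. f s \<noteq> 0} \<Longrightarrow> coef (Abs_fvec f) = f"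
  by (simp add: Abs_fvec_inverse)

instantiation fvec :: (type) real_vector
begin

definition "0 = Abs_fvec (\<lambda>_. 0)"
definition "x + y = Abs_fvec (\<lambda>s. coef x s + coef y s)"
definition "- x = Abs_fvec (\<lambda>s. - coef x s)"
definition "x - y = Abs_fvec (\<lambda>s. coef x s - coef y s)"
definition "c *\<^sub>R x = Abs_fvec (\<lambda>s. c * coef x s)"

lemma coef_zero [simp]: "coef 0 s = 0"
  by (simp add: zero_fvec_def coef_Abs)

lemma coef_add [simp]: "coef (x + y) s = coef x s + coef y s"
proof -
  have "finite {s. coef x s + coef y s \<noteq> 0}"
    by (rule finite_subset[of _ "{s. coef x s \<noteq> 0} \<union> {s. coef y s \<noteq> 0}"]) auto
  then show ?thesis by (simp add: plus_fvec_def coef_Abs)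
qed

lemma coef_uminus [simp]: "coef (- x) s = - coef x s"
  by (simp add: uminus_fvec_def coef_Abs)

lemma coef_diff [simp]: "coef (x - y) s = coef x s - coef y s"
proof -
  have "finite {s. coef x s - coef y s \<noteq> 0}"
    by (rule finite_subset[of _ "{s. coef x s \<noteq> 0} \<union> {s. coef y s \<noteq> 0}"]) auto
  then show ?thesis by (simp add: minus_fvec_def coef_Abs)
qed

lemma coef_scaleR [simp]: "coef (c *\<^sub>R x) s = c * coef x s"
proof -
  have "finite {s. c * coef x s \<noteq> 0}"
    by (rule finite_subset[of _ "{s. coef x s \<noteq> 0}"]) auto
  then show ?thesis by (simp add: scaleR_fvec_def coef_Abs)
qed

instance
  by standard (auto intro!: fvec_eqI simp: algebra_simps)

end

definition unit :: "'s \<Rightarrow> 's fvec"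
  where "unit s = Abs_fvec (\<lambda>t. if t = s then 1 else 0)"

lemma coef_unit [simp]: "coef (unit s) t = (if t = s then 1 else 0)"
  by (simp add: unit_def coef_Abs)

lemma coef_sum [simp]: "coef (sum f A) s = (\<Sum>i\<in>A. coef (f i) s)"
  by (induction A rule: infinite_finite_induct) auto

lemma fvec_expand:
  assumes "finite T" "{s. coef x s \<noteq> 0} \<subseteq> T"
  shows "x = (\<Sum>t\<in>T. coef x t *\<^sub>R unit t)"
proof (rule fvec_eqI)
  fix s
  have "(\<Sum>t\<in>T. coef x t * (if s = t then 1 else 0)) = (\<Sum>t\<in>T. if s = t then coef x s else 0)"
    by (rule sum.cong) auto
  also have "\<dots> = coef x s"
    using assms by (auto simp: sum.delta)
  finally show "coef x s = coef (\<Sum>t\<in>T. coef x t *\<^sub>R unit t) s"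
    by simp
qed

section \<open>The Tits form and the geometric action\<close>

locale coxeter =
  fixes S :: "'s set" and m :: "'s \<Rightarrow> 's \<Rightarrow> enat"
  assumes matrix: "coxeter_matrix S m"
begin

lemma m_sym: "s \<in> S \<Longrightarrow> t \<in> S \<Longrightarrow> m s t = m t s"
  and m_diag: "s \<in> S \<Longrightarrow> m s s = 1"
  and m_off: "s \<in> S \<Longrightarrow> t \<in> S \<Longrightarrow> s \<noteq> t \<Longrightarrow> 2 \<le> m s t"
  using matrix by (auto simp: coxeter_matrix_def)

text \<open>Extending the coefficients by zero outside \<open>S\<close> makes the form symmetric, and the
  reflections isometric, without side conditions.\<close>

definition a :: "'s \<Rightarrow> 's \<Rightarrow> real"
  where "a s t = (if s \<in> S \<and> t \<in> S then tits_coeff m s t else 0)"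

definition B :: "'s fvec \<Rightarrow> 's fvec \<Rightarrow> real"
  where "B x y = (\<Sum>s | coef x s \<noteq> 0. \<Sum>t | coef y t \<noteq> 0. coef x s * coef y t * a s t)"

lemma a_sym: "a s t = a t s"
  by (auto simp: a_def tits_coeff_def m_sym)

lemma a_diag: "s \<in> S \<Longrightarrow> a s s = 1"
  by (simp add: a_def tits_coeff_def m_diag one_enat_def)

lemma a_off_bounds:
  assumes "s \<in> S" "t \<in> S" "s \<noteq> t"
  shows "- 1 \<le> a s t" "a s t \<le> 0"
proof -
  have "- 1 \<le> a s t \<and> a s t \<le> 0"
  proof (cases "m s t")
    case (enat n)
    with m_off[OF assms] have n: "2 \<le> n"
      by (metis enat_ord_simps(1) numeral_eq_enat)
    then have "pi / real n \<le> pi / 2"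
      by (intro divide_left_mono) auto
    moreover have "0 \<le> pi / real n" by simp
    ultimately have "0 \<le> cos (pi / real n)"
      by (intro cos_ge_zero) linarith+
    then show ?thesis
      using enat assms by (auto simp: a_def tits_coeff_def)
  next
    case infinity
    then show ?thesis using assms by (auto simp: a_def tits_coeff_def)
  qed
  then show "- 1 \<le> a s t" "a s t \<le> 0" by auto
qed

lemma abs_a_le: "\<bar>a s t\<bar> \<le> 1"
proof (cases "s \<in> S \<and> t \<in> S")
  case True
  then show ?thesis
    using a_off_bounds[of s t] a_diag[of s] by (cases "s = t") auto
qed (auto simp: a_def)

lemma B_superset:
  assumes "finite T" "finite U" "{s. coef x s \<noteq> 0} \<subseteq> T" "{s. coef y s \<noteq> 0} \<subseteq> U"
  shows "B x y = (\<Sum>s\<in>T. \<Sum>t\<in>U. coef x s * coef y t * a s t)"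
proof -
  have "(\<Sum>t | coef y t \<noteq> 0. coef x s * coef y t * a s t) = (\<Sum>t\<in>U. coef x s * coef y t * a s t)" for s
    by (rule sum.mono_neutral_left) (use assms in auto)
  then have "B x y = (\<Sum>s | coef x s \<noteq> 0. \<Sum>t\<in>U. coef x s * coef y t * a s t)"
    by (simp add: B_def)
  also have "\<dots> = (\<Sum>s\<in>T. \<Sum>t\<in>U. coef x s * coef y t * a s t)"
    by (rule sum.mono_neutral_left) (use assms in auto)
  finally show ?thesis .
qed

lemma B_sym: "B x y = B y x"
  unfolding B_def by (subst sum.swap) (simp add: a_sym mult.commute)

lemma B_add_left [simp]: "B (x + y) z = B x z + B y z"
proof -
  let ?T = "{s. coef x s \<noteq> 0} \<union> {s. coef y s \<noteq> 0}" and ?U = "{s. coef z s \<noteq> 0}"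
  have T: "finite ?T" "finite ?U" by auto
  have "B w z = (\<Sum>s\<in>?T. \<Sum>t\<in>?U. coef w s * coef z t * a s t)" if "{s. coef w s \<noteq> 0} \<subseteq> ?T" for w
    by (rule B_superset[OF T that]) simp
  note w = this
  have "{s. coef (x + y) s \<noteq> 0} \<subseteq> ?T" by auto
  from w[OF this] w[of x] w[of y] show ?thesis
    by (simp add: distrib_right sum.distrib)
qed

lemma B_scaleR_left [simp]: "B (c *\<^sub>R x) z = c * B x z"
proof -
  let ?T = "{s. coef x s \<noteq> 0}" and ?U = "{s. coef z s \<noteq> 0}"
  have T: "finite ?T" "finite ?U" by auto
  have "B w z = (\<Sum>s\<in>?T. \<Sum>t\<in>?U. coef w s * coef z t * a s t)" if "{s. coef w s \<noteq> 0} \<subseteq> ?T" for w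
    by (rule B_superset[OF T that]) simp
  from this[of x] this[of "c *\<^sub>R x"] show ?thesis
    by (auto simp: algebra_simps sum_distrib_left)
qed

lemma B_add_right [simp]: "B z (x + y) = B z x + B z y"
  by (metis B_add_left B_sym)

lemma B_scaleR_right [simp]: "B z (c *\<^sub>R x) = c * B z x"
  by (metis B_scaleR_left B_sym)

lemma B_zero [simp]: "B 0 x = 0" "B x 0 = 0"
  by (simp_all add: B_def)

lemma B_uminus [simp]: "B (- x) y = - B x y" "B x (- y) = - B x y"
  using B_scaleR_left[of "-1" x y] B_scaleR_right[of x "-1" y] by auto

lemma B_diff [simp]: "B (x - y) z = B x z - B y z" "B z (x - y) = B z x - B z y"
  using B_add_left[of x "- y" z] B_add_right[of z x "- y"] by auto

lemma B_sum_left: "B (sum f A) z = (\<Sum>i\<in>A. B (f i) z)"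
  by (induction A rule: infinite_finite_induct) auto

lemma B_sum_right: "B z (sum f A) = (\<Sum>i\<in>A. B z (f i))"
  by (induction A rule: infinite_finite_induct) auto

lemma B_unit [simp]: "B (unit s) (unit t) = a s t"
  by (simp add: B_def)

lemma B_unit_outside: "s \<notin> S \<Longrightarrow> B (unit s) x = 0"
  by (simp add: B_def a_def)

definition reflect :: "'s fvec \<Rightarrow> 's fvec \<Rightarrow> 's fvec"
  where "reflect v x = x - (2 * B v x) *\<^sub>R v"

text \<open>Words act instead of group elements; that equal elements act equally is
  \<open>eqv_act\<close>. The generators are involutions, hence \<open>rev w\<close> is the inverse
  of \<open>w\<close>.\<close>

definition act :: "'s list \<Rightarrow> 's fvec \<Rightarrow> 's fvec"
  where "act w = foldr (\<lambda>s. reflect (unit s)) w"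

lemma act_Nil [simp]: "act [] x = x"
  and act_Cons: "act (s # w) x = reflect (unit s) (act w x)"
  and act_append: "act (u @ v) x = act u (act v x)"
  by (simp_all add: act_def)

lemma reflect_add: "reflect v (x + y) = reflect v x + reflect v y"
  and reflect_scaleR: "reflect v (c *\<^sub>R x) = c *\<^sub>R reflect v x"
  by (simp_all add: reflect_def algebra_simps)

lemma act_add [simp]: "act w (x + y) = act w x + act w y"
  by (induction w) (auto simp: act_Cons reflect_add)

lemma act_scaleR [simp]: "act w (c *\<^sub>R x) = c *\<^sub>R act w x"
  by (induction w) (auto simp: act_Cons reflect_scaleR)

lemma act_zero [simp]: "act w 0 = 0"
  using act_scaleR[of w 0 0] by simp

lemma act_uminus [simp]: "act w (- x) = - act w x"
  using act_scaleR[of w "-1" x] by simp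

lemma act_diff [simp]: "act w (x - y) = act w x - act w y"
  using act_add[of w x "- y"] by simp

lemma act_sum: "act w (sum f A) = (\<Sum>i\<in>A. act w (f i))"
  by (induction A rule: infinite_finite_induct) auto

lemma B_reflect: "B v v = 1 \<Longrightarrow> B (reflect v x) (reflect v y) = B x y"
  by (simp add: reflect_def B_sym[of x v] algebra_simps)

lemma reflect_reflect: "B v v = 1 \<Longrightarrow> reflect v (reflect v x) = x"
  by (simp add: reflect_def algebra_simps)

lemma reflect_unit_reflect_unit [simp]: "reflect (unit s) (reflect (unit s) x) = x"
proof (cases "s \<in> S")
  case False
  then show ?thesis by (simp add: reflect_def B_unit_outside)
qed (simp add: reflect_reflect a_diag)

lemma B_act [simp]: "B (act w x) (act w y) = B x y"
proof (induction w)
  case (Cons s w)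
  have "B (reflect (unit s) u) (reflect (unit s) v) = B u v" for u v
  proof (cases "s \<in> S")
    case False
    then show ?thesis by (simp add: reflect_def B_unit_outside)
  qed (simp add: B_reflect a_diag)
  with Cons show ?case by (simp add: act_Cons)
qed simp

lemma act_rev_act [simp]: "act (rev w) (act w x) = x"
  by (induction w arbitrary: x) (auto simp: act_append act_Cons)

lemma act_act_rev [simp]: "act w (act (rev w) x) = x"
  using act_rev_act[of "rev w" x] by simp

lemma B_act_rev: "B x (act w y) = B (act (rev w) x) y"
  by (metis B_act act_act_rev)

lemma reflect_act: "reflect (act w v) x = act w (reflect v (act (rev w) x))"
proof -
  have "B (act w v) x = B v (act (rev w) x)"
    by (metis B_act act_act_rev)
  then show ?thesis
    by (simp add: reflect_def)
qed

end

text \<open>The right end is the fixed one, since it acts first and carries the descents; parity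
  decides the first letter (\<open>alt_Cons\<close>).\<close>

primrec alt :: "'s \<Rightarrow> 's \<Rightarrow> nat \<Rightarrow> 's list" where
  "alt s t 0 = []"
| "alt s t (Suc k) = alt t s k @ [t]"

lemma length_alt [simp]: "length (alt s t k) = k"
  by (induction k arbitrary: s t) auto

lemma set_alt: "set (alt s t k) \<subseteq> {s, t}"
  by (induction k arbitrary: s t) fastforce+

lemma alt_Cons: "alt s t (Suc k) = (if even k then t else s) # alt s t k"
  by (induction k arbitrary: s t) auto

lemma concat_replicate_eq_alt: "concat (replicate n [s, t]) = alt s t (2 * n)"
proof (induction n)
  case (Suc n)
  have "concat (replicate (Suc n) [s, t]) = [s, t] @ alt s t (2 * n)"
    using Suc by simp
  also have "\<dots> = alt s t (Suc (Suc (2 * n)))"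
    by (simp only: alt_Cons) simp
  finally show ?case by simp
qed simp

lemma rev_alt: "rev (alt s t k) = (if even k then alt t s k else alt s t k)"
proof (induction k arbitrary: s t)
  case (Suc k)
  have "rev (alt s t (Suc k)) = t # rev (alt t s k)" by simp
  also have "\<dots> = (if even (Suc k) then alt t s (Suc k) else alt s t (Suc k))"
    unfolding Suc by (simp only: alt_Cons) simp
  finally show ?case .
qed simp

lemma alt_append: "alt s t (j + k) = (if even k then alt s t j else alt t s j) @ alt s t k"
  by (induction k arbitrary: s t) auto

context coxeter
begin

section \<open>The word problem\<close>

definition R :: "('s word \<times> 's word) set"
  where "R = pres_rel S (coxeter_relators S m)"

definition emb :: "'s list \<Rightarrow> 's word"
  where "emb w = map (\<lambda>s. (s, True)) w"

text \<open>Equality in the group for words without formal inverses. They suffice, because a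
  generator is its own inverse (\<open>emb_fst_R\<close>).\<close>

definition eqv :: "'s list \<Rightarrow> 's list \<Rightarrow> bool" (infix "\<doteq>" 50)
  where "u \<doteq> v \<longleftrightarrow> (emb u, emb v) \<in> R"

lemma emb_simps [simp]: "emb [] = []" "emb (s # w) = (s, True) # emb w" "emb (u @ v) = emb u @ emb v"
  by (simp_all add: emb_def)

lemma emb_words: "emb w \<in> words S \<longleftrightarrow> set w \<subseteq> S"
  by (auto simp: emb_def words_def)

lemma eqv_refl [intro]: "set w \<subseteq> S \<Longrightarrow> w \<doteq> w"
  by (simp add: eqv_def R_def emb_words pres_rel.refl)

lemma eqv_sym: "u \<doteq> v \<Longrightarrow> v \<doteq> u"
  by (auto simp: eqv_def R_def intro: pres_rel.sym)

lemma eqv_trans [trans]: "u \<doteq> v \<Longrightarrow> v \<doteq> w \<Longrightarrow> u \<doteq> w"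
  by (auto simp: eqv_def R_def intro: pres_rel.trans)

lemma eqv_append: "u \<doteq> u' \<Longrightarrow> v \<doteq> v' \<Longrightarrow> u @ v \<doteq> u' @ v'"
  by (auto simp: eqv_def R_def intro: pres_rel.append)

lemma eqv_set: "u \<doteq> v \<Longrightarrow> set u \<subseteq> S" "u \<doteq> v \<Longrightarrow> set v \<subseteq> S"
  using pres_rel_words[of "emb u" "emb v" S] by (auto simp: eqv_def R_def emb_words)

lemma eqv_relator:
  assumes "s \<in> S" "t \<in> S" "m s t = enat n"
  shows "concat (replicate n [s, t]) \<doteq> []"
proof -
  have e: "emb (concat (replicate n [s, t])) = concat (replicate n [(s, True), (t, True)])"
    by (induction n) auto
  have "concat (replicate n [(s, True), (t, True)]) \<in> coxeter_relators S m"
    using assms by (auto simp: coxeter_relators_def)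
  moreover have "emb (concat (replicate n [s, t])) \<in> words S"
    using assms by (subst emb_words) auto
  ultimately show ?thesis
    by (simp add: eqv_def R_def e pres_rel.relator)
qed

lemma eqv_square: "s \<in> S \<Longrightarrow> [s, s] \<doteq> []"
  using eqv_relator[of s s 1] m_diag[of s] by (simp add: one_enat_def)

lemma eqv_rev: "set w \<subseteq> S \<Longrightarrow> rev w @ w \<doteq> []"
proof (induction w)
  case (Cons s w)
  then have "rev w @ ([s, s] @ w) \<doteq> rev w @ ([] @ w)"
    by (intro eqv_append eqv_square eqv_refl) auto
  with Cons show ?case by (auto intro: eqv_trans)
qed auto

lemma eqv_rev': "set w \<subseteq> S \<Longrightarrow> w @ rev w \<doteq> []"
  using eqv_rev[of "rev w"] by simp

lemma eqv_cancel_right: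
  assumes "u @ v \<doteq> w" "set v \<subseteq> S"
  shows "u \<doteq> w @ rev v"
proof -
  have u: "set u \<subseteq> S" using eqv_set(1)[OF assms(1)] by simp
  have "u @ (v @ rev v) \<doteq> u @ []"
    using u assms by (intro eqv_append eqv_rev' eqv_refl)
  moreover have "(u @ v) @ rev v \<doteq> w @ rev v"
    using assms by (intro eqv_append eqv_refl) auto
  ultimately show ?thesis
    by (metis append.right_neutral append_assoc eqv_sym eqv_trans)
qed

text \<open>The relator is the alternating word of length \<open>2 * n\<close>; moving one half of
  it across gives the braid relation.\<close>

lemma braid:
  assumes "s \<in> S" "t \<in> S" "m s t = enat n"
  shows "alt s t n \<doteq> alt t s n"
proof -
  have set: "set (alt s t k) \<subseteq> S" "set (alt t s k) \<subseteq> S" for k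
    using set_alt[of s t k] set_alt[of t s k] assms by auto
  have "(if even n then alt s t n else alt t s n) @ alt s t n \<doteq> []"
    using eqv_relator[OF assms] concat_replicate_eq_alt[of n s t] alt_append[of s t n n]
    by (simp add: mult_2)
  from eqv_cancel_right[OF this] set
  have "(if even n then alt s t n else alt t s n) \<doteq> rev (alt s t n)"
    by auto
  then show ?thesis
    by (auto simp: rev_alt intro: eqv_sym split: if_splits)
qed

lemma emb_fst_R:
  assumes "w \<in> words S"
  shows "(w, emb (map fst w)) \<in> R"
  using assms
proof (induction w)
  case Nil
  then show ?case by (auto simp: R_def intro: pres_rel.refl)
next
  case (Cons x w)
  obtain s b where x: "x = (s, b)" by (cases x)
  with Cons have s: "s \<in> S" and w: "w \<in> words S" by (auto simp: words_def)
  have T: "[(s, c)] \<in> words S" for c using s by (auto simp: words_def)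
  have "([(s, b)], [(s, True)]) \<in> R"
  proof (cases b)
    case True
    then show ?thesis using T by (auto simp: R_def intro: pres_rel.refl)
  next
    case False
    have "([(s, True), (s, True)] @ [(s, False)], [] @ [(s, False)]) \<in> R"
      using eqv_square[OF s] T unfolding R_def eqv_def
      by (intro pres_rel.append pres_rel.refl) auto
    moreover have "([(s, True)] @ [(s, True), (s, False)], [(s, True)] @ []) \<in> R"
      using pres_rel.cancel[OF s, of True] T unfolding R_def
      by (intro pres_rel.append pres_rel.refl) auto
    ultimately show ?thesis
      using False unfolding R_def by (auto intro: pres_rel.trans pres_rel.sym)
  qed
  then have "([(s, b)] @ w, [(s, True)] @ emb (map fst w)) \<in> R"
    using Cons.IH[OF w] unfolding R_def by (rule pres_rel.append)
  then show ?case by (simp add: x)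
qed

lemma act_fix: "(\<And>s. s \<in> set w \<Longrightarrow> B (unit s) x = 0) \<Longrightarrow> act w x = x"
  by (induction w) (auto simp: act_Cons reflect_def)

text \<open>The coefficients of dihedral roots satisfy a Chebyshev recurrence. \<open>W\<close> is
  left abstract because it is a quotient of sines for finite \<open>m s t\<close> and the sequence
  \<open>0, 1, 2, ...\<close> for infinite \<open>m s t\<close>.\<close>

lemma act_alt:
  assumes st: "s \<in> S" "t \<in> S" and W: "W 0 = 0" "W (Suc 0) = 1"
    "\<And>k. W (Suc (Suc k)) = - 2 * a s t * W (Suc k) - W k"
  shows "act (alt s t k) (unit s) =
    (if even k then W (Suc k) *\<^sub>R unit s + W k *\<^sub>R unit t
     else W (Suc k) *\<^sub>R unit t + W k *\<^sub>R unit s)"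
proof (induction k)
  case (Suc k)
  show ?case
    unfolding alt_Cons act_Cons Suc
    using st by (auto simp: reflect_def W(3) a_diag a_sym[of t s] algebra_simps simp flip: scaleR_add_left)
qed (simp add: W)

lemma sin_recurrence: "sin (real (Suc (Suc k)) * \<theta>) = 2 * cos \<theta> * sin (real (Suc k) * \<theta>) - sin (real k * \<theta>)"
proof -
  have "sin (real (Suc (Suc k)) * \<theta>) = sin (real (Suc k) * \<theta> + \<theta>)"
    "sin (real k * \<theta>) = sin (real (Suc k) * \<theta> - \<theta>)"
    by (simp_all add: algebra_simps)
  then show ?thesis by (simp add: sin_add sin_diff)
qed

text \<open>For \<open>s \<noteq> t\<close> the two reflections compose to a rotation of order
  \<open>n\<close> on the plane of \<open>unit s\<close> and \<open>unit t\<close>, and to the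
  identity on vectors orthogonal to it. Both parts together give everything, since the Gram
  determinant \<open>1 - c\<^sup>2\<close> of the plane is the square of
  \<open>sin \<theta> > 0\<close>.\<close>

lemma relator_acts_trivially:
  assumes st: "s \<in> S" "t \<in> S" and n: "m s t = enat n"
  shows "act (concat (replicate n [s, t])) x = x"
proof (cases "s = t")
  case True
  with n m_diag[OF st(1)] have "n = 1" by (simp add: one_enat_def)
  then show ?thesis using True by (simp add: act_Cons)
next
  case False
  have n2: "2 \<le> n" using m_off[OF st False] n
    by (metis enat_ord_simps(1) numeral_eq_enat)
  define \<theta> where "\<theta> = pi / n"
  have a: "a s t = - cos \<theta>"
    using st n by (simp add: a_def tits_coeff_def \<theta>_def)
  have "0 < \<theta>" "\<theta> < pi"
    using n2 by (auto simp: \<theta>_def field_simps)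
  then have sin: "sin \<theta> > 0" by (rule sin_gt_zero)
  have n\<theta>: "real n * \<theta> = pi" using n2 by (simp add: \<theta>_def)
  define W where "W k = sin (real k * \<theta>) / sin \<theta>" for k
  have W: "W 0 = 0" "W (Suc 0) = 1" "\<And>k. W (Suc (Suc k)) = - 2 * a s t * W (Suc k) - W k"
    "\<And>k. W (Suc (Suc k)) = - 2 * a t s * W (Suc k) - W k"
    using sin unfolding W_def sin_recurrence by (auto simp: a a_sym[of t s] diff_divide_distrib)
  have W0: "W (2 * n) = 0"
    using n\<theta> by (simp add: W_def mult.assoc)
  have W1: "W (Suc (2 * n)) = 1"
  proof -
    have "real (Suc (2 * n)) * \<theta> = \<theta> + 2 * pi" using n\<theta> by (simp add: algebra_simps)
    then show ?thesis using sin by (simp add: W_def)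
  qed
  have W2: "W (2 * n - Suc 0) = - 1"
  proof -
    have "Suc (Suc (2 * n - 1)) = Suc (2 * n)" "Suc (2 * n - 1) = 2 * n" using n2 by auto
    with W(3)[of "2 * n - 1"] W0 W1 show ?thesis by simp
  qed
  let ?w = "alt s t (2 * n)"
  have es: "act ?w (unit s) = unit s"
    using act_alt[where W = W, OF st W(1-3), of "2 * n"] by (simp add: W0 W1)
  have "?w = alt t s (2 * n - 1) @ [t]"
    using n2 by (metis Suc_diff_1 alt.simps(2) less_le_trans mult_pos_pos zero_less_numeral)
  moreover have "act (alt t s (2 * n - 1)) (unit t) = - unit t"
    using act_alt[where W = W, OF st(2,1) W(1,2,4), of "2 * n - 1"] n2 by (auto simp: W0) (simp add: W2)
  ultimately have et: "act ?w (unit t) = unit t"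
    using st by (simp add: act_append act_Cons reflect_def a_diag scaleR_2)
  define c where "c = a s t"
  have c: "1 - c\<^sup>2 \<noteq> 0"
    using sin sin_squared_eq[of \<theta>] by (auto simp: c_def a)
  \<comment> \<open>Cramer's rule for the orthogonal projection of \<open>x\<close> to the
    plane.\<close>
  define p q where "p = (B (unit s) x - c * B (unit t) x) / (1 - c\<^sup>2)"
    and "q = (B (unit t) x - c * B (unit s) x) / (1 - c\<^sup>2)"
  define y where "y = x - (p *\<^sub>R unit s + q *\<^sub>R unit t)"
  have "(1 - c\<^sup>2) * p = B (unit s) x - c * B (unit t) x" "(1 - c\<^sup>2) * q = B (unit t) x - c * B (unit s) x"
    unfolding p_def q_def using c by simp_all
  then have "(1 - c\<^sup>2) * (p + q * c) = (1 - c\<^sup>2) * B (unit s) x"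
    "(1 - c\<^sup>2) * (p * c + q) = (1 - c\<^sup>2) * B (unit t) x"
    by (simp_all add: distrib_left flip: mult.assoc) (simp_all add: algebra_simps power2_eq_square)
  then have "p + q * c = B (unit s) x" "p * c + q = B (unit t) x"
    using c by simp_all
  then have "B (unit s) y = 0" "B (unit t) y = 0"
    using st by (auto simp: y_def a_diag a_sym[of t s] c_def[symmetric])
  then have "act ?w y = y"
    using set_alt[of s t "2 * n"] by (intro act_fix) auto
  moreover have x: "x = y + (p *\<^sub>R unit s + q *\<^sub>R unit t)" by (simp add: y_def)
  ultimately have "act ?w x = x"
    by (subst (1 2) x) (simp add: es et)
  then show ?thesis by (simp add: concat_replicate_eq_alt)
qed

lemma pres_rel_act:
  assumes "(u, v) \<in> R"
  shows "act (map fst u) x = act (map fst v) x"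
  using assms unfolding R_def
proof (induction arbitrary: x rule: pres_rel.induct)
  case (relator r)
  then obtain s t n where r: "r = concat (replicate n [(s, True), (t, True)])" "s \<in> S" "t \<in> S"
    "m s t = enat n"
    by (auto simp: coxeter_relators_def)
  have "map fst r = concat (replicate n [s, t])"
    unfolding r by (induction n) auto
  then show ?case using relator_acts_trivially[OF r(2-4)] by simp
qed (auto simp: act_append act_Cons)

lemma eqv_act: "u \<doteq> v \<Longrightarrow> act u x = act v x"
  using pres_rel_act[of "emb u" "emb v" x] by (simp add: eqv_def emb_def comp_def)

section \<open>Word length and positivity of roots\<close>

definition len :: "'s list \<Rightarrow> nat"
  where "len w = (LEAST k. \<exists>v. w \<doteq> v \<and> length v = k)"

lemma len_attained: "set w \<subseteq> S \<Longrightarrow> \<exists>v. w \<doteq> v \<and> length v = len w"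
  unfolding len_def by (rule LeastI) auto

lemma len_le: "w \<doteq> v \<Longrightarrow> len w \<le> length v"
  unfolding len_def by (rule Least_le) auto

lemma shorter_word:
  assumes "set w \<subseteq> S" "s \<in> S" "len (w @ [s]) < n"
  shows "\<exists>v. w \<doteq> v @ [s] \<and> v \<doteq> w @ [s] \<and> length v < n"
proof -
  obtain v where v: "w @ [s] \<doteq> v" "length v = len (w @ [s])"
    using len_attained[of "w @ [s]"] assms by auto
  from eqv_cancel_right[OF v(1)] assms v show ?thesis
    by (auto intro: eqv_sym)
qed

lemma eqv_square_right:
  assumes "w \<doteq> v @ [s]" "s \<in> S"
  shows "w @ [s] \<doteq> v"
  using eqv_cancel_right[OF eqv_sym[OF assms(1)]] assms by (auto intro: eqv_sym)

definition pos :: "'s fvec \<Rightarrow> bool"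
  where "pos x \<longleftrightarrow> (\<forall>s. 0 \<le> coef x s)"

lemma pos_unit [simp]: "pos (unit s)"
  and pos_add: "pos x \<Longrightarrow> pos y \<Longrightarrow> pos (x + y)"
  and pos_scaleR: "0 \<le> c \<Longrightarrow> pos x \<Longrightarrow> pos (c *\<^sub>R x)"
  by (simp_all add: pos_def)

lemma pos_antisym: "pos x \<Longrightarrow> pos (- x) \<Longrightarrow> x = 0"
  by (rule fvec_eqI) (auto simp: pos_def intro: antisym)

text \<open>For \<open>m s t = n\<close> the bound \<open>k < n\<close> keeps the angles
  \<open>k * \<theta>\<close> and \<open>(k + 1) * \<theta>\<close> in \<open>[0, pi]\<close>, where
  the sine is nonnegative.\<close>

lemma dihedral_nonneg:
  assumes st: "s \<in> S" "t \<in> S" "s \<noteq> t" and k: "enat k < m s t"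
  shows "\<exists>p q. 0 \<le> p \<and> 0 \<le> q \<and> act (alt s t k) (unit s) = p *\<^sub>R unit s + q *\<^sub>R unit t"
proof -
  have "\<exists>W. W 0 = 0 \<and> W (Suc 0) = 1 \<and> (\<forall>k. W (Suc (Suc k)) = - 2 * a s t * W (Suc k) - W k)
    \<and> 0 \<le> W k \<and> 0 \<le> W (Suc k)"
  proof (cases "m s t")
    case infinity
    then show ?thesis
      using st by (intro exI[of _ real]) (auto simp: a_def tits_coeff_def)
  next
    case (enat n)
    define \<theta> where "\<theta> = pi / n"
    have kn: "Suc k \<le> n" using k enat by simp
    have n2: "2 \<le> n" using m_off[OF st] enat
      by (metis enat_ord_simps(1) numeral_eq_enat)
    have a: "a s t = - cos \<theta>"
      using st enat by (simp add: a_def tits_coeff_def \<theta>_def)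
    have \<theta>: "0 < \<theta>" "\<theta> < pi"
      using n2 by (auto simp: \<theta>_def field_simps)
    then have sin: "sin \<theta> > 0" by (rule sin_gt_zero)
    have nn: "0 \<le> sin (real j * \<theta>)" if "j \<le> n" for j
    proof (rule sin_ge_zero)
      show "0 \<le> real j * \<theta>" using \<theta> by simp
      have "real j * \<theta> \<le> real n * \<theta>" using that \<theta> by simp
      then show "real j * \<theta> \<le> pi" using n2 by (simp add: \<theta>_def)
    qed
    define W where "W k = sin (real k * \<theta>) / sin \<theta>" for k
    have "W 0 = 0" "W (Suc 0) = 1" using sin by (auto simp: W_def)
    moreover have "W (Suc (Suc k)) = - 2 * a s t * W (Suc k) - W k" for k
      unfolding W_def sin_recurrence by (simp add: a diff_divide_distrib)
    moreover have "0 \<le> W k" "0 \<le> W (Suc k)"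
      unfolding W_def using sin nn[OF kn] nn[of k] kn by auto
    ultimately show ?thesis by blast
  qed
  then obtain W where W: "W 0 = 0" "W (Suc 0) = 1"
    "\<And>k. W (Suc (Suc k)) = - 2 * a s t * W (Suc k) - W k" "0 \<le> W k" "0 \<le> W (Suc k)"
    by auto
  have "act (alt s t k) (unit s) = (if even k then W (Suc k) *\<^sub>R unit s + W k *\<^sub>R unit t
     else W (Suc k) *\<^sub>R unit t + W k *\<^sub>R unit s)"
    using act_alt[where W = W, OF st(1,2) W(1-3)] .
  with W(4,5) show ?thesis
    by (cases "even k") (auto simp: add.commute[of "W (Suc k) *\<^sub>R unit t"])
qed

text \<open>Write \<open>w\<close> as a shortest word ending in as long an alternating word in \<open>s\<close> and \<open>t\<close> as
  possible; what precedes it is shorter and has neither \<open>s\<close> nor \<open>t\<close> as a descent.\<close>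

theorem act_unit_pos:
  assumes "set w \<subseteq> S" "s \<in> S" "len w \<le> len (w @ [s])"
  shows "pos (act w (unit s))"
  using assms
proof (induction "len w" arbitrary: w s rule: less_induct)
  case less
  note w = \<open>set w \<subseteq> S\<close> and s = \<open>s \<in> S\<close>
  obtain v0 where v0: "w \<doteq> v0" "length v0 = len w"
    using len_attained[OF w] by auto
  show ?case
  proof (cases v0 rule: rev_exhaust)
    case Nil
    then show ?thesis using eqv_act[OF v0(1)] by simp
  next
    case (snoc v' t)
    have t: "t \<in> S" using eqv_set(2)[OF v0(1)] snoc by simp
    have no_s: "False" if "w \<doteq> u @ [s]" "length u < len w" for u
      using len_le[OF eqv_square_right[OF that(1) s]] that(2) less.prems(3) by simp
    have st: "s \<noteq> t"
      using no_s[of v'] v0 snoc by auto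
    have alt_S: "set (alt s t j) \<subseteq> S" "set (alt t s j) \<subseteq> S" for j
      using set_alt[of s t j] set_alt[of t s j] s t by auto
    define P where "P k \<longleftrightarrow> (\<exists>v. w \<doteq> v @ alt s t k \<and> length v + k = len w)" for k
    have "P 1" using v0 snoc by (auto simp: P_def)
    moreover have "\<forall>k. P k \<longrightarrow> k \<le> len w" by (auto simp: P_def)
    ultimately obtain k where k: "P k" "\<And>j. P j \<Longrightarrow> j \<le> k"
      by (metis GreatestI_nat Greatest_le_nat)
    have "1 \<le> k" using k(2)[OF \<open>P 1\<close>] .
    obtain v where v: "w \<doteq> v @ alt s t k" "length v + k = len w"
      using k(1) by (auto simp: P_def)
    have vS: "set v \<subseteq> S" using eqv_set(2)[OF v(1)] by simp
    have vmin: "length v \<le> length u" if "v \<doteq> u" for u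
    proof -
      have "w \<doteq> u @ alt s t k"
        using eqv_trans[OF v(1) eqv_append[OF that eqv_refl[OF alt_S(1)]]] .
      from len_le[OF this] v(2) show ?thesis by simp
    qed
    then have len_v: "len v = length v"
      by (metis antisym len_attained len_le eqv_refl vS)
    \<comment> \<open>\<open>y\<close> is the first letter of the alternating tail, \<open>x\<close>
      the letter that would prolong it to the left. A descent \<open>x\<close> of \<open>v\<close>
      would contradict the maximality of \<open>k\<close>; a descent \<open>y\<close> would cancel
      against the tail and shorten \<open>w\<close>.\<close>
    define x y where "x = (if even k then t else s)" and "y = (if even k then s else t)"
    have xy: "x \<in> S" "y \<in> S" using s t by (auto simp: x_def y_def)
    have altx: "alt s t (Suc k) = [x] @ alt s t k"
      unfolding alt_Cons by (simp add: x_def)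
    have alty: "alt s t k = [y] @ alt s t (k - 1)"
      using alt_Cons[of s t "k - 1"] \<open>1 \<le> k\<close> by (simp add: y_def)
    have 1: "len v \<le> len (v @ [x])"
    proof (rule ccontr)
      assume "\<not> len v \<le> len (v @ [x])"
      then obtain u where u: "v \<doteq> u @ [x]" "length u < length v"
        using shorter_word[OF vS xy(1), of "length v"] len_v by auto
      have "w \<doteq> (u @ [x]) @ alt s t k"
        using eqv_trans[OF v(1) eqv_append[OF u(1) eqv_refl[OF alt_S(1)]]] .
      then have w': "w \<doteq> u @ alt s t (Suc k)" unfolding altx by simp
      with len_le[OF this] u(2) v(2) have "P (Suc k)" unfolding P_def by fastforce
      then show False using k(2) by fastforce
    qed
    have 2: "len v \<le> len (v @ [y])"
    proof (rule ccontr)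
      assume "\<not> len v \<le> len (v @ [y])"
      then obtain u where u: "u \<doteq> v @ [y]" "length u < length v"
        using shorter_word[OF vS xy(2), of "length v"] len_v by auto
      have "w \<doteq> (v @ [y]) @ alt s t (k - 1)"
        using v(1) unfolding alty by simp
      moreover have "(v @ [y]) @ alt s t (k - 1) \<doteq> u @ alt s t (k - 1)"
        using alt_S by (intro eqv_append eqv_sym[OF u(1)] eqv_refl)
      ultimately have "w \<doteq> u @ alt s t (k - 1)" by (rule eqv_trans)
      from len_le[OF this] u(2) v(2) show False by simp
    qed
    have "len v < len w" using len_v v(2) \<open>1 \<le> k\<close> by simp
    then have "pos (act v (unit x))" "pos (act v (unit y))"
      using less.hyps[of v] vS xy 1 2 by auto
    then have pos: "pos (act v (unit s))" "pos (act v (unit t))"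
      by (auto simp: x_def y_def split: if_splits)
    \<comment> \<open>Otherwise the braid relation rewrites the tail so that it ends in
      \<open>s\<close>, which makes \<open>s\<close> a descent of \<open>w\<close>.\<close>
    have "enat k < m s t"
    proof (rule ccontr)
      assume "\<not> enat k < m s t"
      then obtain n where n: "m s t = enat n" "n \<le> k"
        by (cases "m s t") auto
      have "n \<noteq> 0"
        using m_off[OF s t st] n by (metis enat_ord_simps(1) numeral_eq_enat not_numeral_le_zero)
      define u where "u = (if even n then alt s t (k - n) else alt t s (k - n))"
      have u: "set u \<subseteq> S" "length u = k - n" using alt_S by (auto simp: u_def)
      have "alt s t k = u @ alt s t n"
        using alt_append[of s t "k - n" n] n by (simp add: u_def)
      with v(1) have "w \<doteq> (v @ u) @ alt s t n" by simp
      moreover have "(v @ u) @ alt s t n \<doteq> (v @ u) @ alt t s n"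
        using vS u s t n by (intro eqv_append eqv_refl braid) auto
      moreover have "alt t s n = alt s t (n - 1) @ [s]"
        using \<open>n \<noteq> 0\<close> by (cases n) auto
      ultimately have "w \<doteq> (v @ u @ alt s t (n - 1)) @ [s]"
        by (metis append_assoc eqv_trans)
      from no_s[OF this] u v(2) n \<open>n \<noteq> 0\<close> show False by auto
    qed
    from dihedral_nonneg[OF s t st this] obtain p q where pq: "0 \<le> p" "0 \<le> q"
      "act (alt s t k) (unit s) = p *\<^sub>R unit s + q *\<^sub>R unit t"
      by auto
    have "act w (unit s) = p *\<^sub>R act v (unit s) + q *\<^sub>R act v (unit t)"
      by (simp add: eqv_act[OF v(1)] act_append pq)
    then show ?thesis
      using pos pq by (auto intro: pos_add pos_scaleR)
  qed
qed

lemma act_unit_neg: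
  assumes "set w \<subseteq> S" "s \<in> S" "len (w @ [s]) < len w"
  shows "pos (- act w (unit s))"
proof -
  obtain v where v: "w \<doteq> v @ [s]" "v \<doteq> w @ [s]" "length v < len w"
    using shorter_word[OF assms] by auto
  have "len v \<le> length v"
    using len_le eqv_refl eqv_set(1)[OF v(2)] by blast
  moreover have "len w \<le> len (v @ [s])"
    using len_attained[of "v @ [s]"] eqv_set(2)[OF v(1)] v(1) by (metis eqv_trans len_le)
  ultimately have "pos (act v (unit s))"
    using v(3) eqv_set(1)[OF v(2)] assms(2) by (intro act_unit_pos) auto
  moreover have "act w (unit s) = - act v (unit s)"
    using assms(2) by (simp add: eqv_act[OF v(1)] act_append act_Cons reflect_def a_diag scaleR_2)
  ultimately show ?thesis by simp
qed

text \<open>A nonempty shortest word has its last letter as a descent and therefore makes the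
  corresponding simple root negative.\<close>

theorem faithful:
  assumes w: "set w \<subseteq> S" and pos: "\<And>s. s \<in> S \<Longrightarrow> pos (act w (unit s))"
  shows "w \<doteq> []"
proof -
  obtain v where v: "w \<doteq> v" "length v = len w"
    using len_attained[OF w] by auto
  show ?thesis
  proof (cases v rule: rev_exhaust)
    case Nil
    then show ?thesis using v by simp
  next
    case (snoc u s)
    have s: "s \<in> S" using eqv_set(2)[OF v(1)] snoc by simp
    have "len (w @ [s]) \<le> length u"
      using v snoc s by (intro len_le eqv_square_right) auto
    then have "pos (- act w (unit s))"
      using v snoc s w by (intro act_unit_neg) auto
    with pos[OF s] have "act w (unit s) = 0" by (rule pos_antisym)
    then have "B (act w (unit s)) (act w (unit s)) = 0" by simp
    then show ?thesis unfolding B_act using s by (simp add: a_diag)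
  qed
qed

section \<open>Roots\<close>

definition roots :: "'s fvec set"
  where "roots = {act w (unit s) |w s. set w \<subseteq> S \<and> s \<in> S}"

lemma unit_roots [intro]: "s \<in> S \<Longrightarrow> unit s \<in> roots"
  unfolding roots_def by (auto intro!: exI[of _ "[]"])

lemma act_roots [intro]: "x \<in> roots \<Longrightarrow> set w \<subseteq> S \<Longrightarrow> act w x \<in> roots"
proof -
  assume "x \<in> roots" and w: "set w \<subseteq> S"
  then obtain u s where "set u \<subseteq> S" "s \<in> S" "x = act u (unit s)"
    by (auto simp: roots_def)
  with w have "set (w @ u) \<subseteq> S" "act w x = act (w @ u) (unit s)"
    by (auto simp: act_append)
  then show ?thesis using \<open>s \<in> S\<close> unfolding roots_def by blast
qed

lemma B_root: "x \<in> roots \<Longrightarrow> B x x = 1"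
  by (auto simp: roots_def a_diag)

lemma reflect_root: 
  assumes "x \<in> roots"
  obtains w where "set w \<subseteq> S" "\<And>y. act w y = reflect x y"
proof -
  obtain u s where u: "set u \<subseteq> S" "s \<in> S" "x = act u (unit s)"
    using assms by (auto simp: roots_def)
  have "act (u @ [s] @ rev u) y = reflect x y" for y
    by (simp add: u reflect_act act_append act_Cons)
  then show ?thesis using u by (intro that[of "u @ [s] @ rev u"]) auto
qed

lemma reflect_self: "B x x = 1 \<Longrightarrow> reflect x x = - x"
  by (simp add: reflect_def scaleR_2)

lemma uminus_root: "x \<in> roots \<Longrightarrow> - x \<in> roots"
  by (metis reflect_root act_roots reflect_self B_root)

lemma root_sign:
  assumes "x \<in> roots"
  shows "pos x \<or> pos (- x)"
proof -
  obtain u s where u: "set u \<subseteq> S" "s \<in> S" "x = act u (unit s)"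
    using assms by (auto simp: roots_def)
  then show ?thesis
    using act_unit_pos[of u s] act_unit_neg[of u s] by (cases "len u \<le> len (u @ [s])") auto
qed

lemma root_not_both: "x \<in> roots \<Longrightarrow> pos x \<Longrightarrow> \<not> pos (- x)"
  using pos_antisym[of x] B_root[of x] by auto

definition V :: "'s fvec set"
  where "V = {x. \<forall>s. s \<notin> S \<longrightarrow> coef x s = 0}"

lemma unit_V [simp]: "s \<in> S \<Longrightarrow> unit s \<in> V"
  and V_add [simp]: "x \<in> V \<Longrightarrow> y \<in> V \<Longrightarrow> x + y \<in> V"
  and V_diff [simp]: "x \<in> V \<Longrightarrow> y \<in> V \<Longrightarrow> x - y \<in> V"
  and V_uminus [simp]: "x \<in> V \<Longrightarrow> - x \<in> V"
  and V_scaleR [simp]: "x \<in> V \<Longrightarrow> c *\<^sub>R x \<in> V"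
  by (auto simp: V_def)

lemma V_supp: "x \<in> V \<Longrightarrow> {s. coef x s \<noteq> 0} \<subseteq> S"
  by (auto simp: V_def)

lemma act_V [simp]: "set w \<subseteq> S \<Longrightarrow> x \<in> V \<Longrightarrow> act w x \<in> V"
  by (induction w) (auto simp: act_Cons reflect_def)

lemma roots_V: "x \<in> roots \<Longrightarrow> x \<in> V"
  by (auto simp: roots_def)

lemma V_induct [consumes 1, case_names unit add scaleR]:
  assumes "x \<in> V" and unit: "\<And>s. s \<in> S \<Longrightarrow> P (unit s)"
    and add: "\<And>x y. x \<in> V \<Longrightarrow> y \<in> V \<Longrightarrow> P x \<Longrightarrow> P y \<Longrightarrow> P (x + y)"
    and scaleR: "\<And>c x. x \<in> V \<Longrightarrow> P x \<Longrightarrow> P (c *\<^sub>R x)"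
    and zero: "P 0"
  shows "P x"
proof -
  have "P (\<Sum>t\<in>T. coef x t *\<^sub>R unit t) \<and> (\<Sum>t\<in>T. coef x t *\<^sub>R unit t) \<in> V" if "finite T" "T \<subseteq> S" for T
    using that
  proof (induction T rule: finite_induct)
    case empty
    then show ?case using zero by (auto simp: V_def)
  qed (auto intro!: add scaleR unit)
  from this[of "{s. coef x s \<noteq> 0}"] show ?thesis
    using V_supp[OF assms(1)] fvec_expand[of "{s. coef x s \<noteq> 0}" x] by simp
qed

text \<open>The reflection changes only the coordinate at \<open>s\<close>, and \<open>x\<close> has
  a positive one elsewhere; a single positive coordinate decides the sign of a root.\<close>

lemma pos_reflect_unit:
  assumes x: "x \<in> roots" "pos x" and s: "s \<in> S" and ne: "x \<noteq> unit s"
  shows "pos (reflect (unit s) x)"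
proof -
  have y: "reflect (unit s) x \<in> roots"
    using act_roots[OF x(1), of "[s]"] s by (simp add: act_Cons)
  have "\<exists>t. t \<noteq> s \<and> coef x t \<noteq> 0"
  proof (rule ccontr)
    assume "\<not> ?thesis"
    then have eq: "x = coef x s *\<^sub>R unit s" by (intro fvec_eqI) auto
    have "B x x = (coef x s)\<^sup>2"
      using s by (subst (1 2) eq) (simp add: a_diag power2_eq_square)
    then have "coef x s = 1"
      using B_root[OF x(1)] x(2) by (simp add: pos_def power2_eq_1_iff) (metis neg_0_le_iff_le not_one_le_zero)
    with eq ne show False by simp
  qed
  then obtain t where t: "t \<noteq> s" "coef x t > 0"
    using x(2) by (auto simp: pos_def less_le)
  then have "coef (reflect (unit s) x) t > 0" by (simp add: reflect_def)
  then have "\<not> pos (- reflect (unit s) x)" by (auto simp: pos_def not_le)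
  with root_sign[OF y] show ?thesis by blast
qed

text \<open>These roots are the walls between two chambers; by \<open>pos_reflect_unit\<close> each
  letter of \<open>w\<close> adds at most one.\<close>

lemma finite_inversions:
  assumes "set w \<subseteq> S"
  shows "finite {x \<in> roots. pos x \<and> pos (- act w x)}"
  using assms
proof (induction w rule: rev_induct)
  case Nil
  have "{x \<in> roots. pos x \<and> pos (- act [] x)} = {}"
    using root_not_both by auto
  then show ?case by (metis finite.emptyI)
next
  case (snoc s w)
  let ?I = "{x \<in> roots. pos x \<and> pos (- act w x)}"
  have s: "s \<in> S" using snoc by simp
  have "{x \<in> roots. pos x \<and> pos (- act (w @ [s]) x)} \<subseteq> insert (unit s) (reflect (unit s) ` ?I)"
  proof
    fix x assume "x \<in> {x \<in> roots. pos x \<and> pos (- act (w @ [s]) x)}"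
    then have x: "x \<in> roots" "pos x" "pos (- act w (reflect (unit s) x))"
      by (auto simp: act_append act_Cons)
    show "x \<in> insert (unit s) (reflect (unit s) ` ?I)"
    proof (cases "x = unit s")
      case False
      have "reflect (unit s) x \<in> ?I"
        using pos_reflect_unit[OF x(1,2) s False] x act_roots[OF x(1), of "[s]"] s
        by (simp add: act_Cons)
      moreover have "x = reflect (unit s) (reflect (unit s) x)" by simp
      ultimately show ?thesis by blast
    qed simp
  qed
  moreover have "finite ?I" using snoc by simp
  ultimately show ?case by (meson finite_imageI finite_insert finite_subset)
qed

section \<open>Parallel walls\<close>

text \<open>The roots \<open>(s\<^sub>x s\<^sub>y)\<^sup>k x\<close> are positive combinations of \<open>x\<close> and \<open>y\<close>, so all of these
  infinitely many walls would separate the two chambers.\<close>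

lemma parallel_walls:
  assumes x: "x \<in> roots" and y: "y \<in> roots" and B: "B x y \<le> - 1"
    and u: "set u \<subseteq> S" "pos (act u x)" "pos (act u y)"
    and w: "set w \<subseteq> S" "pos (- act w x)" "pos (- act w y)"
  shows False
proof -
  define \<gamma> where "\<gamma> k = ((\<lambda>z. reflect x (reflect y z)) ^^ k) x" for k
  define c where "c = - B x y"
  have c: "1 \<le> c" using B by (simp add: c_def)
  have Bs: "B x x = 1" "B y y = 1" "B x y = - c" "B y x = - c"
    using B_root x y by (auto simp: c_def B_sym)
  obtain wx where wx: "set wx \<subseteq> S" "\<And>z. act wx z = reflect x z" using reflect_root[OF x] by blast
  obtain wy where wy: "set wy \<subseteq> S" "\<And>z. act wy z = reflect y z" using reflect_root[OF y] by blast
  have root: "\<gamma> k \<in> roots" for k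
    by (induction k) (use x act_roots[OF _ wx(1)] act_roots[OF _ wy(1)] in \<open>auto simp: \<gamma>_def wx(2) wy(2)\<close>)
  \<comment> \<open>The gap between the coefficients never falls below its initial value 1:
    \<open>c \<ge> 1\<close> gives \<open>q' - p \<ge> p - q\<close> and
    \<open>p' - q' \<ge> q' - p\<close>. Hence \<open>p\<close> grows at least linearly.\<close>
  have comb: "\<exists>p q. \<gamma> k = p *\<^sub>R x + q *\<^sub>R y \<and> 0 \<le> q \<and> q + 1 \<le> p \<and> real k \<le> p" for k
  proof (induction k)
    case 0
    show ?case by (intro exI[of _ 1] exI[of _ 0]) (simp add: \<gamma>_def)
  next
    case (Suc k)
    then obtain p q where pq: "\<gamma> k = p *\<^sub>R x + q *\<^sub>R y" "0 \<le> q" "q + 1 \<le> p" "real k \<le> p"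
      by auto
    define q' where "q' = 2 * c * p - q"
    define p' where "p' = 2 * c * q' - p"
    have "\<gamma> (Suc k) = reflect x (reflect y (\<gamma> k))" by (simp add: \<gamma>_def)
    also have "reflect y (\<gamma> k) = p *\<^sub>R x + q' *\<^sub>R y"
      unfolding pq q'_def by (intro fvec_eqI) (simp add: reflect_def Bs algebra_simps)
    also have "reflect x \<dots> = p' *\<^sub>R x + q' *\<^sub>R y"
      unfolding p'_def by (intro fvec_eqI) (simp add: reflect_def Bs algebra_simps)
    finally have "\<gamma> (Suc k) = p' *\<^sub>R x + q' *\<^sub>R y" .
    moreover have "p \<le> c * p" using c pq by (simp add: mult_le_cancel_right1)
    then have q': "2 * p - q \<le> q'" by (simp add: q'_def)
    moreover have "q' \<le> c * q'" using c q' pq by (simp add: mult_le_cancel_right1)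
    then have "2 * q' - p \<le> p'" by (simp add: p'_def)
    ultimately show ?case using pq by (intro exI[of _ p'] exI[of _ q']) auto
  qed
  let ?I = "{z \<in> roots. pos z \<and> pos (- act (w @ rev u) z)}"
  have I: "act u (\<gamma> k) \<in> ?I" for k
  proof -
    obtain p q where pq: "\<gamma> k = p *\<^sub>R x + q *\<^sub>R y" "0 \<le> q" "q + 1 \<le> p"
      using comb by blast
    have "pos (act u (\<gamma> k))"
      using u pq by (auto intro!: pos_add pos_scaleR)
    moreover have "- act w (\<gamma> k) = p *\<^sub>R (- act w x) + q *\<^sub>R (- act w y)"
      using pq by simp
    then have "pos (- act w (\<gamma> k))"
      using w pq by (auto intro!: pos_add pos_scaleR simp del: scaleR_minus_right)
    ultimately show ?thesis
      using root[of k] u(1) by (auto simp: act_append)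
  qed
  have fin: "finite ?I" by (rule finite_inversions) (use u w in auto)
  \<comment> \<open>Finiteness is refuted by an unbounded coordinate of the roots
    \<open>\<gamma> k\<close> rather than by their distinctness.\<close>
  have "act u x \<noteq> 0"
    using B_root[OF x] by (metis act_rev_act act_zero B_zero(1) zero_neq_one)
  then obtain t where t: "0 < coef (act u x) t"
    using u(2) by (metis coef_zero fvec_eqI less_eq_real_def pos_def)
  have "bdd_above ((\<lambda>z. coef z t) ` ?I)" using fin by simp
  then obtain M where M: "\<And>z. z \<in> ?I \<Longrightarrow> coef z t \<le> M"
    by (auto simp: bdd_above_def)
  obtain k :: nat where k: "M / coef (act u x) t < k"
    using reals_Archimedean2 by blast
  obtain p q where pq: "\<gamma> k = p *\<^sub>R x + q *\<^sub>R y" "0 \<le> q" "real k \<le> p"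
    using comb by blast
  have "M < real k * coef (act u x) t" using k t by (simp add: field_simps)
  also have "\<dots> \<le> p * coef (act u x) t + q * coef (act u y) t"
    using pq t u(3) by (intro add_increasing2 mult_right_mono) (auto simp: pos_def)
  also have "\<dots> = coef (act u (\<gamma> k)) t" using pq by simp
  finally show False using M[OF I[of k]] by simp
qed

section \<open>Hyperbolic elements\<close>

text \<open>For an isotropic pair this is a hyperbolic rotation: it multiplies \<open>v\<close> by
  \<open>r\<close> and \<open>w\<close> by \<open>1 / r\<close> and fixes every vector orthogonal to
  both.\<close>

definition boost :: "'s fvec \<Rightarrow> 's fvec \<Rightarrow> real \<Rightarrow> 's fvec \<Rightarrow> 's fvec"
  where "boost v w r x = x + (2 * (r - 1) * B w x) *\<^sub>R v + (2 * (1 / r - 1) * B v x) *\<^sub>R w"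

text \<open>The value \<open>1 / 2\<close> gives \<open>B (v + w) (v + w) = 1\<close>, so that
  \<open>v + w\<close> can be a root.\<close>

definition isotropic_pair :: "'s fvec \<Rightarrow> 's fvec \<Rightarrow> bool"
  where "isotropic_pair v w \<longleftrightarrow> B v v = 0 \<and> B w w = 0 \<and> B v w = 1 / 2"

lemma isotropic_pair_sym: "isotropic_pair v w \<Longrightarrow> isotropic_pair w v"
  by (simp add: isotropic_pair_def B_sym)

lemma boost_swap: "boost w v r = boost v w (1 / r)"
  by (simp add: boost_def fun_eq_iff)

lemma boost_boost:
  assumes "isotropic_pair v w" "r \<noteq> 0" "r' \<noteq> 0"
  shows "boost v w r (boost v w r' x) = boost v w (r * r') x"
proof -
  have iso: "B v v = 0" "B w w = 0" "B v w = 1 / 2" "B w v = 1 / 2"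
    using assms(1) by (simp_all add: isotropic_pair_def B_sym[of w v])
  have b: "B v (boost v w r' x) = 1 / r' * B v x" "B w (boost v w r' x) = r' * B w x"
    unfolding boost_def by (simp_all add: iso algebra_simps)
  show ?thesis
    unfolding boost_def[of v w r] b unfolding boost_def
    using assms(2,3) by (simp add: algebra_simps divide_simps flip: scaleR_add_left)
qed

lemma boost_1 [simp]: "boost v w 1 x = x"
  by (simp add: boost_def)

lemma act_power_boost:
  assumes "isotropic_pair v w" "r \<noteq> 0" "\<And>x. act g x = boost v w r x"
  shows "act (concat (replicate k g)) x = boost v w (r ^ k) x"
  by (induction k) (use assms in \<open>auto simp: act_append boost_boost\<close>)

lemma act_rev_boost:
  assumes "isotropic_pair v w" "r \<noteq> 0" "\<And>x. act g x = boost v w r x"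
  shows "act (rev g) x = boost v w (1 / r) x"
proof -
  have "x = act g (boost v w (1 / r) x)"
    using assms by (simp add: boost_boost)
  then show ?thesis by (metis act_rev_act)
qed

lemma boost_axis:
  assumes "isotropic_pair v w"
  shows "boost v w r (v + w) = r *\<^sub>R v + (1 / r) *\<^sub>R w"
  using assms by (simp add: boost_def isotropic_pair_def B_sym[of w v] algebra_simps)

text \<open>The plane of \<open>x\<close> and \<open>y\<close> is Lorentzian, and \<open>v\<close>,
  \<open>w\<close> span its isotropic lines. On the hyperbola \<open>t v + w / t\<close> the roots
  have the parameters \<open>1\<close> and \<open>l\<close>, and the two reflections compose to the
  translation by twice their distance, whence \<open>\<mu> = l * l\<close>.\<close>

lemma hyperbolic_pair:
  assumes x: "x \<in> roots" and y: "y \<in> roots" and B: "B x y > 1"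
  obtains v w \<mu> where "isotropic_pair v w" "x = v + w" "v \<in> V" "w \<in> V" "\<mu> > 1"
    "\<And>z. reflect y (reflect x z) = boost v w \<mu> z"
proof -
  define c where "c = B x y"
  \<comment> \<open>The larger root of \<open>l\<^sup>2 - 2 * c * l + 1\<close>, that is,
    \<open>c = cosh (ln l)\<close>; \<open>v\<close> and \<open>w\<close> then solve
    \<open>x = v + w\<close> and \<open>y = l v + w / l\<close>.\<close>
  define l where "l = c + sqrt (c\<^sup>2 - 1)"
  have c: "c > 1" using B by (simp add: c_def)
  then have c2: "c\<^sup>2 - 1 \<ge> 0" by (simp add: one_le_power)
  have l1: "l > 1" unfolding l_def using c c2 real_sqrt_ge_zero[OF c2] by linarith
  have "(l - c)\<^sup>2 = c\<^sup>2 - 1" unfolding l_def using c2 by simp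
  then have "l * l + 1 = 2 * c * l" by (simp add: power2_eq_square algebra_simps)
  then have lc: "2 * c = l + 1 / l" using l1 by (simp add: field_simps)
  define D where "D = l - 1 / l"
  have "1 / l < 1" using l1 by simp
  then have D: "D > 0" using l1 unfolding D_def by linarith
  define v w where "v = (1 / D) *\<^sub>R (y - (1 / l) *\<^sub>R x)" and "w = (1 / D) *\<^sub>R (l *\<^sub>R x - y)"
  have xvw: "x = v + w"
  proof -
    have "v + w = (1 / D) *\<^sub>R ((l - 1 / l) *\<^sub>R x)"
      unfolding v_def w_def by (simp add: algebra_simps)
    then show ?thesis using D by (simp add: D_def)
  qed
  have yvw: "y = l *\<^sub>R v + (1 / l) *\<^sub>R w"
  proof -
    have "l *\<^sub>R v + (1 / l) *\<^sub>R w = (1 / D) *\<^sub>R (l *\<^sub>R (y - (1 / l) *\<^sub>R x) + (1 / l) *\<^sub>R (l *\<^sub>R x - y))"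
      unfolding v_def w_def by (simp add: algebra_simps)
    also have "l *\<^sub>R (y - (1 / l) *\<^sub>R x) + (1 / l) *\<^sub>R (l *\<^sub>R x - y) = (l - 1 / l) *\<^sub>R y"
      using l1 by (simp add: algebra_simps)
    finally show ?thesis using D by (simp add: D_def)
  qed
  have Bs: "B x x = 1" "B y y = 1" "B x y = c" "B y x = c"
    using B_root x y by (auto simp: c_def B_sym)
  have "1 + (1 / l) * (1 / l) - 2 * c * (1 / l) = 0" "l * l + 1 - 2 * c * l = 0"
    unfolding lc using l1 by (auto simp: field_simps)
  then have "B (y - (1 / l) *\<^sub>R x) (y - (1 / l) *\<^sub>R x) = 0" "B (l *\<^sub>R x - y) (l *\<^sub>R x - y) = 0"
    by (auto simp: Bs algebra_simps)
  then have vv: "B v v = 0" and ww: "B w w = 0"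
    unfolding v_def w_def B_scaleR_left B_scaleR_right by auto
  have "B x x = 2 * B v w" by (simp add: xvw vv ww B_sym[of w v])
  then have vw: "B v w = 1 / 2" by (simp add: Bs)
  have iso: "isotropic_pair v w" using vv ww vw by (simp add: isotropic_pair_def)
  have V: "v \<in> V" "w \<in> V" using x y by (auto simp: v_def w_def roots_V)
  have "reflect y (reflect x z) = boost v w (l * l) z" for z
  proof -
    define P Q where "P = B v z" and "Q = B w z"
    define Z where "Z = z - (2 * (P + Q)) *\<^sub>R v - (2 * (P + Q)) *\<^sub>R w"
    have Z: "reflect x z = Z"
      unfolding reflect_def Z_def by (simp add: xvw P_def Q_def algebra_simps)
    have BZ: "B y Z = - (P / l) - Q * l"
      unfolding Z_def yvw by (simp add: P_def[symmetric] Q_def[symmetric] vv ww vw B_sym[of w v] algebra_simps add_divide_distrib)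
    have "reflect y (reflect x z) = Z - (2 * (- (P / l) - Q * l)) *\<^sub>R y"
      by (simp only: Z reflect_def[of y] BZ)
    also have "\<dots> = Z + (2 * (P / l + Q * l)) *\<^sub>R y"
      by (intro fvec_eqI) (simp add: algebra_simps)
    also have "\<dots> = Z + (2 * (P / l + Q * l)) *\<^sub>R (l *\<^sub>R v + (1 / l) *\<^sub>R w)"
      by (simp only: yvw[symmetric])
    also have "(2 * (P / l + Q * l)) *\<^sub>R (l *\<^sub>R v + (1 / l) *\<^sub>R w) =
      (2 * P + 2 * Q * (l * l)) *\<^sub>R v + (2 * P * (1 / (l * l)) + 2 * Q) *\<^sub>R w"
      using l1 by (simp add: algebra_simps)
    also have "Z + \<dots> = z + (2 * (l * l - 1) * Q) *\<^sub>R v + (2 * (1 / (l * l) - 1) * P) *\<^sub>R w"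
      unfolding Z_def by (intro fvec_eqI) (simp add: algebra_simps)
    finally show ?thesis by (simp add: boost_def P_def Q_def)
  qed
  moreover have "l * l > 1" using l1 by (simp add: less_1_mult)
  ultimately show ?thesis using that[OF iso xvw V] by blast
qed

text \<open>For large \<open>r\<close> the boosted vector is nearly \<open>r v\<close>, and its
  reflection in \<open>d\<close> nearly \<open>r (v - 2 P d)\<close>, where \<open>P = B v d\<close>
  and \<open>Q = B w d\<close>. The products with \<open>v\<close> and \<open>w\<close> are then
  about \<open>- 2 r P\<^sup>2\<close> and \<open>r (1 / 2 - 2 P Q)\<close>, of opposite signs as
  \<open>P Q < 1 / 4\<close>.\<close>

lemma boost_reflect_sign:
  assumes iso: "isotropic_pair v w" and mu: "\<mu> > 1" and d: "B d d = 1" 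
    and P: "B v d \<noteq> 0" and PQ: "B v d * B w d < 1 / 4"
  shows "\<exists>k. let z = reflect d (boost v w (\<mu> ^ k) (v + w)) in B v z * B w z < 0"
proof -
  define P Q \<theta> where "P = B v d" and "Q = B w d" and "\<theta> = 1 / 2 - 2 * P * Q"
  have \<theta>: "\<theta> > 0" using PQ by (simp add: \<theta>_def P_def Q_def)
  have P0: "P\<^sup>2 > 0" using P by (simp add: P_def)
  obtain k where k: "max 1 (max (\<theta> / (2 * P\<^sup>2)) (2 * Q\<^sup>2 / \<theta>)) < \<mu> ^ k"
    using real_arch_pow[OF mu] by blast
  define r where "r = \<mu> ^ k"
  have r: "r > 1" "\<theta> < r * (2 * P\<^sup>2)" "2 * Q\<^sup>2 < r * \<theta>"
    using k \<theta> P0 by (auto simp: r_def divide_less_eq)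
  have rr: "r \<le> r * r" using r(1) by simp
  have r2: "\<theta> < r * r * (2 * P\<^sup>2)" "2 * Q\<^sup>2 < r * r * \<theta>"
    using r(2,3) mult_right_mono[OF rr, of "2 * P\<^sup>2"] mult_right_mono[OF rr, of \<theta>] \<theta> by auto
  define z where "z = reflect d (boost v w r (v + w))"
  have iso': "B v v = 0" "B w w = 0" "B v w = 1 / 2" "B w v = 1 / 2"
    using iso by (simp_all add: isotropic_pair_def B_sym[of w v])
  have z: "z = r *\<^sub>R v + (1 / r) *\<^sub>R w - (2 * (r * P + Q / r)) *\<^sub>R d"
    unfolding z_def boost_axis[OF iso] by (simp add: reflect_def P_def Q_def B_sym[of d])
  have "B v z = (1 / r) * (\<theta> - r * r * (2 * P\<^sup>2))"
    unfolding z using r(1) by (simp add: iso' P_def[symmetric] \<theta>_def field_simps power2_eq_square)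
  then have "B v z < 0" using r2 r(1) by (simp add: divide_less_0_iff)
  moreover have "B w z = (1 / r) * (r * r * \<theta> - 2 * Q\<^sup>2)"
    unfolding z using r(1) by (simp add: iso' Q_def[symmetric] \<theta>_def field_simps power2_eq_square)
  then have "B w z > 0" using r2 r(1) by simp
  ultimately show ?thesis
    unfolding z_def r_def by (intro exI[of _ k]) (simp add: mult_less_0_iff)
qed

text \<open>If \<open>B v z * B w z\<close> were nonnegative on the whole orbit, then, reflecting
  \<open>r v + w / r\<close> with \<open>r\<close> extreme, it would be at least \<open>1 / 4\<close> on every root not orthogonal
  to \<open>v\<close> and \<open>w\<close>. When \<open>v + w\<close> is a simple root, \<open>B v z + B w z\<close> lies in \<open>[-1, 1]\<close> for
  simple \<open>z\<close>, which forces \<open>B v z = B w z\<close>, so \<open>v - w\<close> would be in the radical.\<close>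

lemma unseparated_root:
  assumes iso: "isotropic_pair v w" and V: "v \<in> V" "w \<in> V" and x: "v + w \<in> roots" and mu: "\<mu> > 1"
    and g: "set g \<subseteq> S" "\<And>z. act g z = boost v w \<mu> z"
  obtains u where "set u \<subseteq> S" "B v (act u (v + w)) * B w (act u (v + w)) < 0"
proof (rule ccontr)
  assume "\<not> thesis"
  with that have H: "0 \<le> B v (act u (v + w)) * B w (act u (v + w))" if "set u \<subseteq> S" for u
    using that not_le by blast
  obtain y s where y: "set y \<subseteq> S" "s \<in> S" "v + w = act y (unit s)"
    using x by (auto simp: roots_def)
  have mu0: "\<mu> \<noteq> 0" using mu by simp
  have iso': "B v v = 0" "B w w = 0" "B v w = 1 / 2" "B w v = 1 / 2"
    using iso by (simp_all add: isotropic_pair_def B_sym[of w v])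
  have quarter: "1 / 4 \<le> B v d * B w d" if d: "d \<in> roots" and nz: "B v d \<noteq> 0 \<or> B w d \<noteq> 0" for d
  proof (rule ccontr)
    assume lt: "\<not> 1 / 4 \<le> B v d * B w d"
    obtain h where h: "set h \<subseteq> S" "\<And>z. act h z = reflect d z"
      using reflect_root[OF d] by blast
    from nz show False
    proof
      assume "B v d \<noteq> 0"
      with boost_reflect_sign[OF iso mu B_root[OF d]] lt obtain k where
        "B v (reflect d (boost v w (\<mu> ^ k) (v + w))) * B w (reflect d (boost v w (\<mu> ^ k) (v + w))) < 0"
        by (auto simp: Let_def)
      moreover have "set (h @ concat (replicate k g)) \<subseteq> S" using h g by auto
      ultimately show False
        using H[of "h @ concat (replicate k g)"] act_power_boost[OF iso mu0 g(2)]
        by (simp add: act_append h(2) del: act_add)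
    next
      assume "B w d \<noteq> 0"
      with boost_reflect_sign[OF isotropic_pair_sym[OF iso] mu B_root[OF d]] lt obtain k where
        "B w (reflect d (boost w v (\<mu> ^ k) (w + v))) * B v (reflect d (boost w v (\<mu> ^ k) (w + v))) < 0"
        by (auto simp: Let_def mult.commute)
      moreover have "act (rev g) z = boost w v \<mu> z" for z
        using act_rev_boost[OF iso mu0 g(2)] by (simp add: boost_swap[of w])
      note act_power_boost[OF isotropic_pair_sym[OF iso] mu0 this]
      moreover have "set (h @ concat (replicate k (rev g))) \<subseteq> S" using h g by auto
      ultimately show False
        using H[of "h @ concat (replicate k (rev g))"]
        by (simp add: act_append h(2) add.commute[of v] mult.commute del: act_add)
    qed
  qed
  \<comment> \<open>\<open>act y\<close> moves the simple roots to a system that contains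
    \<open>v + w\<close>, so \<open>P + Q\<close> is a matrix coefficient. Unless both vanish,
    \<open>(P - Q)\<^sup>2 = (P + Q)\<^sup>2 - 4 * P * Q \<le> 0\<close>.\<close>
  have eq: "B v (act y (unit t)) = B w (act y (unit t))" if t: "t \<in> S" for t
  proof -
    define P Q where "P = B v (act y (unit t))" and "Q = B w (act y (unit t))"
    have sum: "P + Q = a s t"
      using y(3) by (simp add: P_def Q_def flip: B_add_left)
    show ?thesis
    proof (cases "P = 0 \<and> Q = 0")
      case False
      have root: "act y (unit t) \<in> roots" using t y by auto
      with quarter[OF root] False have "1 / 4 \<le> P * Q" by (auto simp: P_def Q_def)
      moreover have "(P + Q)\<^sup>2 \<le> 1"
        using abs_a_le[of s t] unfolding sum by (simp add: abs_square_le_1)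
      ultimately have "(P - Q)\<^sup>2 \<le> 0"
        by (simp add: power2_eq_square algebra_simps)
      then show ?thesis by (simp add: P_def Q_def)
    qed (simp add: P_def Q_def)
  qed
  have "B (v - w) (act y z) = 0" if "z \<in> V" for z
    using that by (induction z rule: V_induct) (auto simp: eq)
  from this[of "act (rev y) v"] y V have "B (v - w) v = 0" by simp
  then show False by (simp add: iso')
qed

section \<open>Affine, spherical and indefinite forms\<close>

lemma graph_iff:
  assumes "s \<in> S" "t \<in> S" "s \<noteq> t"
  shows "(s, t) \<in> coxeter_graph S m \<longleftrightarrow> a s t \<noteq> 0"
proof (cases "m s t")
  case (enat n)
  have n2: "2 \<le> n" using m_off[OF assms] enat
    by (metis enat_ord_simps(1) numeral_eq_enat)
  have "3 \<le> m s t \<longleftrightarrow> 3 \<le> n"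
    unfolding enat by (metis enat_ord_simps(1) numeral_eq_enat)
  moreover have "cos (pi / n) \<noteq> 0" if "3 \<le> n"
  proof -
    have "pi / n < pi / 2" using that by (intro divide_strict_left_mono) auto
    moreover have "0 < pi / n" using that by simp
    ultimately have "0 < cos (pi / n)" by (intro cos_gt_zero)
    then show ?thesis by simp
  qed
  moreover have "cos (pi / n) = 0" if "\<not> 3 \<le> n"
  proof -
    have "n = 2" using that n2 by simp
    then show ?thesis by simp
  qed
  ultimately show ?thesis
    using assms enat by (auto simp: coxeter_graph_def a_def tits_coeff_def)
next
  case infinity
  then show ?thesis
    using assms by (auto simp: coxeter_graph_def a_def tits_coeff_def)
qed

lemma graph_cases:
  assumes "(s, t) \<in> coxeter_graph S m"
  shows "s \<in> S" "t \<in> S" "s \<noteq> t" "a s t < 0"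
proof -
  show st: "s \<in> S" "t \<in> S" using assms by (auto simp: coxeter_graph_def)
  show ne: "s \<noteq> t"
  proof
    assume "s = t"
    with assms m_diag[OF st(1)] have "(3::enat) \<le> 1" by (auto simp: coxeter_graph_def)
    then show False by (simp add: one_enat_def numeral_eq_enat)
  qed
  show "a s t < 0"
    using graph_iff[OF st ne] a_off_bounds[OF st ne] assms by simp
qed

lemma connected_induct:
  assumes "irreducible_coxeter S m" "s \<in> S" "P s"
    and step: "\<And>s t. (s, t) \<in> coxeter_graph S m \<Longrightarrow> P s \<Longrightarrow> P t" and t: "t \<in> S"
  shows "P t"
proof -
  have "(s, t) \<in> (coxeter_graph S m)\<^sup>*"
    using assms by (auto simp: irreducible_coxeter_def)
  then show ?thesis
    by (induction rule: rtrancl_induct) (use assms in auto)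
qed

lemma B_unit_sum:
  assumes "finite T" "{s. coef x s \<noteq> 0} \<subseteq> T"
  shows "B x y = (\<Sum>t\<in>T. coef x t * B (unit t) y)"
proof -
  have "B x y = B (\<Sum>t\<in>T. coef x t *\<^sub>R unit t) y"
    using fvec_expand[OF assms] by simp
  then show ?thesis by (simp add: B_sum_left)
qed

text \<open>Perron-Frobenius argument: at a vertex \<open>t\<close> outside the support all terms of
  \<open>B \<rho> (unit t)\<close> are nonpositive, and a neighbour in the support contributes a
  negative one. So the support spreads along edges.\<close>

lemma null_vector_full_support:
  assumes irr: "irreducible_coxeter S m" and \<rho>: "pos \<rho>" "\<rho> \<in> V" "\<rho> \<noteq> 0"
    and null: "\<And>s. s \<in> S \<Longrightarrow> B \<rho> (unit s) = 0" and s: "s \<in> S"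
  shows "coef \<rho> s > 0"
proof -
  obtain s0 where s0: "coef \<rho> s0 \<noteq> 0" using \<rho>(3) by (metis coef_zero fvec_eqI)
  show ?thesis
  proof (rule connected_induct[OF irr _ _ _ s])
    show "s0 \<in> S" "coef \<rho> s0 > 0" using s0 \<rho> by (auto simp: V_def pos_def less_le)
    fix s t assume g: "(s, t) \<in> coxeter_graph S m" and s: "coef \<rho> s > 0"
    note st = graph_cases[OF g]
    show "coef \<rho> t > 0"
    proof (rule ccontr)
      assume "\<not> coef \<rho> t > 0"
      then have t0: "coef \<rho> t = 0" using \<rho>(1) by (auto simp: pos_def less_le)
      let ?T = "{s. coef \<rho> s \<noteq> 0}"
      have "(\<Sum>u\<in>?T. coef \<rho> u * B (unit u) (unit t)) < (\<Sum>u\<in>?T. 0)"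
      proof (rule sum_strict_mono_ex1)
        show "\<forall>u\<in>?T. coef \<rho> u * B (unit u) (unit t) \<le> 0"
          using \<rho>(1) V_supp[OF \<rho>(2)] t0 st a_off_bounds(2)[of _ t]
          by (auto simp: pos_def mult_le_0_iff)
        show "\<exists>u\<in>?T. coef \<rho> u * B (unit u) (unit t) < 0"
          using s st by (intro bexI[of _ s]) (auto simp: mult_pos_neg)
      qed simp
      moreover have "B \<rho> (unit t) = (\<Sum>u\<in>?T. coef \<rho> u * B (unit u) (unit t))"
        by (rule B_unit_sum) auto
      ultimately show False using null[OF st(2)] by simp
    qed
  qed
qed

text \<open>The row sums weighted by \<open>\<rho>\<close> vanish, which turns the form into a graph
  Laplacian in the function \<open>coef x / coef \<rho>\<close>, with edge weights
  \<open>- a s t * coef \<rho> s * coef \<rho> t\<close>. Each edge occurs twice in the sum, hence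
  the factor 2.\<close>

lemma form_sum_of_squares:
  assumes S: "finite S" and \<rho>: "\<rho> \<in> V" "\<And>s. s \<in> S \<Longrightarrow> coef \<rho> s > 0"
    and null: "\<And>s. s \<in> S \<Longrightarrow> B \<rho> (unit s) = 0" and x: "x \<in> V"
  shows "- 2 * B x x = (\<Sum>s\<in>S. \<Sum>t\<in>S. a s t * coef \<rho> s * coef \<rho> t * (coef x s / coef \<rho> s - coef x t / coef \<rho> t)\<^sup>2)"
proof -
  define r y where "r = coef \<rho>" and "y s = coef x s / coef \<rho> s" for s
  have xr: "coef x s = y s * r s" if "s \<in> S" for s
    using \<rho>(2)[OF that] by (simp add: y_def r_def)
  have row: "(\<Sum>t\<in>S. a s t * r t) = 0" if "s \<in> S" for s
    using null[OF that] B_unit_sum[OF S V_supp[OF \<rho>(1)], of "unit s"]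
    by (simp add: r_def a_sym[of s] mult.commute)
  have "(\<Sum>s\<in>S. \<Sum>t\<in>S. a s t * r s * r t * (y s - y t)\<^sup>2) =
    (\<Sum>s\<in>S. \<Sum>t\<in>S. (r s * (y s)\<^sup>2) * (a s t * r t)) + (\<Sum>s\<in>S. \<Sum>t\<in>S. (r t * (y t)\<^sup>2) * (a s t * r s))
    - 2 * (\<Sum>s\<in>S. \<Sum>t\<in>S. (y s * r s) * (y t * r t) * a s t)"
    unfolding sum_distrib_left sum_subtractf[symmetric] sum.distrib[symmetric]
    by (auto simp: power2_eq_square algebra_simps intro!: sum.cong)
  also have "(\<Sum>s\<in>S. \<Sum>t\<in>S. (r s * (y s)\<^sup>2) * (a s t * r t)) = 0"
    by (simp add: sum_distrib_left[symmetric] row)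
  also have "(\<Sum>s\<in>S. \<Sum>t\<in>S. (r t * (y t)\<^sup>2) * (a s t * r s)) = 0"
    by (subst sum.swap) (simp add: sum_distrib_left[symmetric] row a_sym[of _ t for t])
  also have "(\<Sum>s\<in>S. \<Sum>t\<in>S. (y s * r s) * (y t * r t) * a s t) = B x x"
    using B_superset[OF S S V_supp[OF x] V_supp[OF x]] by (simp add: xr)
  finally show ?thesis by (simp add: y_def r_def)
qed

lemma tits_form_eq_B:
  assumes "x \<in> tits_space S" "y \<in> tits_space S"
  shows "tits_form m x y = B (Abs_fvec x) (Abs_fvec y)" "Abs_fvec x \<in> V"
proof -
  have [simp]: "coef (Abs_fvec x) = x" "coef (Abs_fvec y) = y"
    using assms by (auto simp: tits_space_def coef_Abs)
  show "tits_form m x y = B (Abs_fvec x) (Abs_fvec y)"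
    unfolding tits_form_def B_def using assms
    by (auto simp: tits_space_def a_def intro!: sum.cong)
  show "Abs_fvec x \<in> V" using assms by (auto simp: tits_space_def V_def)
qed

lemma coef_tits_space: "x \<in> V \<Longrightarrow> coef x \<in> tits_space S"
  by (auto simp: tits_space_def V_def)

text \<open>\<open>S\<close> lies in the support of \<open>\<rho>\<close> and is finite. The
  Laplacian is semidefinite and, the graph being connected, vanishes only where
  \<open>coef x / coef \<rho>\<close> is constant, that is, on the multiples of
  \<open>\<rho>\<close>.\<close>

theorem null_vector_affine:
  assumes irr: "irreducible_coxeter S m" and \<rho>: "pos \<rho>" "\<rho> \<in> V" "\<rho> \<noteq> 0"
    and null: "\<And>s. s \<in> S \<Longrightarrow> B \<rho> (unit s) = 0"
  shows "affine_type S m"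
proof -
  have p: "coef \<rho> s > 0" if "s \<in> S" for s
    by (rule null_vector_full_support[OF irr \<rho> null that])
  have "S \<subseteq> {s. coef \<rho> s \<noteq> 0}" using p by fastforce
  then have S: "finite S" by (rule finite_subset) simp
  have psd: "0 \<le> B x x" and zero: "B x x = 0 \<Longrightarrow> \<exists>c. x = c *\<^sub>R \<rho>" if x: "x \<in> V" for x
  proof -
    define q where "q s t = a s t * coef \<rho> s * coef \<rho> t * (coef x s / coef \<rho> s - coef x t / coef \<rho> t)\<^sup>2" for s t
    have sq: "- 2 * B x x = (\<Sum>s\<in>S. \<Sum>t\<in>S. q s t)"
      unfolding q_def by (rule form_sum_of_squares[OF S \<rho>(2) p null x])
    have q: "q s t \<le> 0" if "s \<in> S" "t \<in> S" for s t
    proof (cases "s = t")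
      case False
      then show ?thesis unfolding q_def
        using a_off_bounds(2)[OF that False] p[OF that(1)] p[OF that(2)]
        by (intro mult_nonpos_nonneg) auto
    qed (simp add: q_def)
    have "(\<Sum>s\<in>S. \<Sum>t\<in>S. q s t) \<le> 0" by (intro sum_nonpos q)
    with sq show "0 \<le> B x x" by simp
    assume "B x x = 0"
    with sq have "(\<Sum>s\<in>S. \<Sum>t\<in>S. - q s t) = 0" by (simp add: sum_negf)
    then have q0: "q s t = 0" if "s \<in> S" "t \<in> S" for s t
      using that S q by (auto simp: sum_nonneg_eq_0_iff sum_nonneg)
    obtain s0 where s0: "s0 \<in> S" using irr by (auto simp: irreducible_coxeter_def)
    have "coef x t / coef \<rho> t = coef x s0 / coef \<rho> s0" if "t \<in> S" for t
    proof (rule connected_induct[OF irr s0 _ _ that])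
      fix s t assume "(s, t) \<in> coxeter_graph S m" "coef x s / coef \<rho> s = coef x s0 / coef \<rho> s0"
      then show "coef x t / coef \<rho> t = coef x s0 / coef \<rho> s0"
        using graph_cases[of s t] q0[of s t] p[of s] p[of t] by (auto simp: q_def)
    qed simp
    then have "coef x t = coef x s0 / coef \<rho> s0 * coef \<rho> t" if "t \<in> S" for t
      using p[OF that] that by (metis less_irrefl nonzero_eq_divide_eq)
    then have "x = (coef x s0 / coef \<rho> s0) *\<^sub>R \<rho>"
      using x \<rho>(2) by (intro fvec_eqI) (metis (mono_tags, lifting) V_def coef_scaleR mem_Collect_eq mult_zero_right)
    then show "\<exists>c. x = c *\<^sub>R \<rho>" by blast
  qed
  have null': "B \<rho> x = 0" if "x \<in> V" for x
    using that by (induction x rule: V_induct) (auto simp: null)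
  have ker: "tits_kernel S m = {(\<lambda>s. c * coef \<rho> s) |c. True}"
  proof (rule equalityI; rule subsetI)
    fix x assume "x \<in> tits_kernel S m"
    then have x: "x \<in> tits_space S" "tits_form m x x = 0" by (auto simp: tits_kernel_def)
    then obtain c where "Abs_fvec x = c *\<^sub>R \<rho>"
      using zero[of "Abs_fvec x"] tits_form_eq_B[OF x(1) x(1)] by auto
    moreover have "x = coef (Abs_fvec x)" using x by (auto simp: tits_space_def coef_Abs)
    ultimately have "x = (\<lambda>s. c * coef \<rho> s)" by (metis coef_scaleR ext)
    then show "x \<in> {(\<lambda>s. c * coef \<rho> s) |c. True}" by blast
  next
    fix x assume "x \<in> {(\<lambda>s. c * coef \<rho> s) |c. True}"
    then obtain c where c: "x = coef (c *\<^sub>R \<rho>)" by (auto simp: fun_eq_iff)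
    then have xs: "x \<in> tits_space S" and ax: "Abs_fvec x = c *\<^sub>R \<rho>"
      using \<rho>(2) by (auto intro!: coef_tits_space simp: coef_inverse)
    have "tits_form m x y = 0" if y: "y \<in> tits_space S" for y
      using tits_form_eq_B(1)[OF xs y] tits_form_eq_B(2)[OF y y] null' by (simp add: ax)
    with xs show "x \<in> tits_kernel S m" by (simp add: tits_kernel_def)
  qed
  have "coef \<rho> \<noteq> (\<lambda>_. 0)" using \<rho>(3) by (metis coef_zero fvec_eqI)
  moreover have "0 \<le> tits_form m x x" if "x \<in> tits_space S" for x
    using psd tits_form_eq_B[OF that that] by simp
  ultimately show ?thesis
    unfolding affine_type_def using irr S ker by blast
qed

text \<open>\<open>l\<close> is the least eigenvalue on the span of \<open>T\<close>, the minimum of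
  the form on the unit sphere. Passing to absolute values does not increase the form, because
  off-diagonal coefficients are at most 0; this makes \<open>z\<close> nonnegative.\<close>

lemma form_minimum:
  assumes T: "finite T" "T \<noteq> {}" "T \<subseteq> S"
  obtains z l where "pos z" "z \<noteq> 0" "{s. coef z s \<noteq> 0} \<subseteq> T"
    "\<And>y. {s. coef y s \<noteq> 0} \<subseteq> T \<Longrightarrow> l * (\<Sum>t\<in>T. (coef y t)\<^sup>2) \<le> B y y"
    "\<And>t. t \<in> T \<Longrightarrow> B z (unit t) = l * coef z t"
proof -
  define q :: "('s \<Rightarrow> real) \<Rightarrow> real" where "q f = (\<Sum>s\<in>T. \<Sum>t\<in>T. f s * f t * a s t)" for f
  define n :: "('s \<Rightarrow> real) \<Rightarrow> real" where "n f = (\<Sum>t\<in>T. (f t)\<^sup>2)" for f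
  \<comment> \<open>The cube in the coordinates \<open>T\<close>, with all other coordinates pinned
    to 0, is compact by Tychonoff's theorem.\<close>
  define I :: "'s \<Rightarrow> real set" where "I s = (if s \<in> T then {-1..1} else {0})" for s
  define K where "K = PiE UNIV I \<inter> {f. n f = 1}"
  have "compactin euclidean (PiE UNIV I)"
    unfolding euclidean_product_topology[symmetric] compactin_PiE by (auto simp: I_def)
  then have "compact (PiE UNIV I)" by simp
  moreover have cn: "continuous_on UNIV n" and cq: "continuous_on UNIV q"
    unfolding n_def q_def
    by (intro continuous_intros continuous_on_product_coordinates)+
  then have "closed {f. n f = 1}"
    using closed_Collect_eq[of n "\<lambda>_. 1"] by simp
  ultimately have K: "compact K" unfolding K_def by (rule compact_Int_closed)
  obtain t0 where t0: "t0 \<in> T" using T by auto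
  have "(\<lambda>t. if t = t0 then 1 else 0) \<in> K"
    using t0 T(1) by (auto simp: K_def n_def I_def if_distrib[of "\<lambda>x. x ^ 2"] cong: if_cong)
  then have "K \<noteq> {}" by blast
  then obtain f where f: "f \<in> K" and fmin: "\<And>g. g \<in> K \<Longrightarrow> q f \<le> q g"
    using continuous_attains_inf[OF K _ continuous_on_subset[OF cq]] by auto
  define l where "l = q f"
  have supp: "f s = 0" if "s \<notin> T" for s
    using f that by (auto simp: K_def I_def PiE_def Pi_def) (metis singletonD)
  define z where "z = Abs_fvec (\<lambda>s. \<bar>f s\<bar>)"
  have cz: "coef z = (\<lambda>s. \<bar>f s\<bar>)"
    unfolding z_def by (rule coef_Abs, rule finite_subset[OF _ T(1)]) (use supp in auto)
  have zT: "{s. coef z s \<noteq> 0} \<subseteq> T" using supp by (auto simp: cz)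
  have Bq: "B y y = q (coef y)" if "{s. coef y s \<noteq> 0} \<subseteq> T" for y
    unfolding q_def by (rule B_superset[OF T(1) T(1) that that])
  have low: "l * n (coef y) \<le> B y y" if y: "{s. coef y s \<noteq> 0} \<subseteq> T" for y
  proof (cases "n (coef y) = 0")
    case True
    then have "\<forall>t\<in>T. coef y t = 0"
      using T(1) by (simp add: n_def sum_nonneg_eq_0_iff)
    then have "y = 0" using y by (intro fvec_eqI) auto
    then show ?thesis by (simp add: n_def)
  next
    case False
    then have N: "n (coef y) > 0" by (simp add: n_def less_le sum_nonneg)
    define c where "c = 1 / sqrt (n (coef y))"
    have c2: "c\<^sup>2 = 1 / n (coef y)" using N by (simp add: c_def power_divide)
    define g where "g s = c * coef y s" for s
    have ng: "n g = 1"
      using N unfolding n_def g_def power_mult_distrib sum_distrib_left[symmetric] c2 by simp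
    have "\<bar>g t\<bar> \<le> 1" if "t \<in> T" for t
    proof -
      have "(g t)\<^sup>2 \<le> n g" unfolding n_def using T(1) that by (intro member_le_sum) auto
      then show ?thesis using ng by (simp add: abs_square_le_1)
    qed
    then have "g \<in> K" using ng y by (auto simp: K_def I_def g_def abs_le_iff)
    then have "l \<le> q g" unfolding l_def by (rule fmin)
    also have "q g = c\<^sup>2 * q (coef y)"
      by (simp add: q_def g_def sum_distrib_left power2_eq_square mult_ac)
    finally show ?thesis using N by (simp add: c2 Bq[OF y] field_simps)
  qed
  have nz: "n (coef z) = 1" using f by (simp add: cz n_def K_def)
  have "q (coef z) \<le> q f"
    unfolding q_def cz
  proof (intro sum_mono)
    fix s t assume st: "s \<in> T" "t \<in> T"
    show "\<bar>f s\<bar> * \<bar>f t\<bar> * a s t \<le> f s * f t * a s t"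
    proof (cases "s = t")
      case False
      have "f s * f t \<le> \<bar>f s\<bar> * \<bar>f t\<bar>" by (metis abs_ge_self abs_mult)
      then show ?thesis
        using a_off_bounds(2)[of s t] st False T by (intro mult_right_mono_neg) auto
    qed simp
  qed
  with low[OF zT] nz have Bz: "B z z = l" by (simp add: Bq[OF zT] l_def)
  have eig: "B z (unit t) = l * coef z t" if t: "t \<in> T" for t
  proof (rule ccontr)
    assume ne: "B z (unit t) \<noteq> l * coef z t"
    \<comment> \<open>With a defect \<open>d\<close> in the eigenvalue equation, the step
      \<open>e\<close> along \<open>unit t\<close> would push the form below \<open>low\<close>;
      \<open>k\<close> is a positive upper bound of \<open>1 - l\<close>, the coefficient of
      \<open>e\<^sup>2\<close>.\<close>
    define d where "d = B z (unit t) - l * coef z t"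
    define k where "k = \<bar>1 - l\<bar> + 1"
    define e where "e = - d / k"
    have k: "k > 0" by (simp add: k_def)
    have tS: "t \<in> S" using t T by auto
    let ?y = "z + e *\<^sub>R unit t"
    have "{s. coef ?y s \<noteq> 0} \<subseteq> T" using zT t by auto
    note low[OF this]
    moreover have "n (coef ?y) = (\<Sum>s\<in>T. (coef z s)\<^sup>2 + (if s = t then 2 * e * coef z t + e\<^sup>2 else 0))"
      unfolding n_def by (intro sum.cong) (auto simp: power2_eq_square algebra_simps)
    then have "n (coef ?y) = 1 + (2 * e * coef z t + e\<^sup>2)"
      using t T(1) nz by (simp add: sum.distrib n_def)
    moreover have "B ?y ?y = l + 2 * e * B z (unit t) + e\<^sup>2"
      using Bz tS by (simp add: B_sym[of "unit t"] a_diag power2_eq_square distrib_left)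
    ultimately have "0 \<le> 2 * e * d + (1 - l) * e\<^sup>2"
      by (simp add: d_def algebra_simps)
    also have "\<dots> \<le> 2 * e * d + k * e\<^sup>2"
      by (intro add_left_mono mult_right_mono) (auto simp: k_def)
    also have "\<dots> = - (d\<^sup>2 / k)"
    proof -
      have "k * e\<^sup>2 = d\<^sup>2 / k" using k by (simp add: e_def power2_eq_square)
      moreover have "e * d = - (d\<^sup>2 / k)" by (simp add: e_def power2_eq_square)
      ultimately show ?thesis by simp
    qed
    also have "\<dots> < 0" using ne k by (simp add: d_def)
    finally show False by simp
  qed
  have "z \<noteq> 0" using nz by (auto simp: n_def)
  moreover have "pos z" by (simp add: pos_def cz)
  ultimately show ?thesis
    using that[of z l] zT low eig by (simp add: n_def)
qed

section \<open>Classes of words as group elements\<close>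

abbreviation G :: "'s word set monoid"
  where "G \<equiv> coxeter_group S m"

definition cls :: "'s list \<Rightarrow> 's word set"
  where "cls w = R `` {emb w}"

lemma group_G: "group G"
  unfolding coxeter_group_def by (rule group_presented_group)

lemma one_G: "\<one>\<^bsub>G\<^esub> = cls []"
  by (simp add: coxeter_group_def presented_group_def cls_def R_def)

lemma mult_G: "set u \<subseteq> S \<Longrightarrow> set v \<subseteq> S \<Longrightarrow> cls u \<otimes>\<^bsub>G\<^esub> cls v = cls (u @ v)"
  unfolding cls_def coxeter_group_def R_def
  by (subst presented_group_mult) (simp_all add: emb_words)

lemma cls_eq_iff:
  assumes "set u \<subseteq> S" "set v \<subseteq> S"
  shows "cls u = cls v \<longleftrightarrow> u \<doteq> v"
  using eq_equiv_class_iff[OF equiv_pres_rel, of "emb u" S "emb v"] assms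
  by (simp add: cls_def eqv_def R_def emb_words)

lemma carrier_G: "carrier G = cls ` {w. set w \<subseteq> S}"
proof -
  have "carrier G = words S // R"
    by (simp add: coxeter_group_def presented_group_def R_def)
  also have "\<dots> = cls ` {w. set w \<subseteq> S}"
  proof (rule equalityI; rule subsetI)
    fix x assume "x \<in> words S // R"
    then obtain w where w: "w \<in> words S" "x = R `` {w}" by (rule quotientE)
    have "x = cls (map fst w)"
      using equiv_class_eq[OF equiv_pres_rel] emb_fst_R[OF w(1)] w(2)
      by (simp add: cls_def R_def)
    moreover have "set (map fst w) \<subseteq> S" using w(1) by (auto simp: words_def)
    ultimately show "x \<in> cls ` {w. set w \<subseteq> S}" by blast
  next
    fix x assume "x \<in> cls ` {w. set w \<subseteq> S}"
    then show "x \<in> words S // R"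
      by (auto simp: cls_def emb_words intro!: quotientI)
  qed
  finally show ?thesis .
qed

lemma cls_carrier [simp]: "set w \<subseteq> S \<Longrightarrow> cls w \<in> carrier G"
  by (auto simp: carrier_G)

lemma inv_G: "set w \<subseteq> S \<Longrightarrow> inv\<^bsub>G\<^esub> cls w = cls (rev w)"
  by (rule group.inv_equality[OF group_G])
    (auto simp: mult_G one_G cls_eq_iff eqv_rev)

section \<open>Positive definite forms and finiteness\<close>

text \<open>If the form is positive definite, the matrix coefficients are bounded. Two elements with
  nearly equal matrices differ by an element so close to the identity that it keeps all simple
  roots positive.\<close>

lemma finite_if_positive_definite:
  assumes S: "finite S" and l: "l > 0" and low: "\<And>y. y \<in> V \<Longrightarrow> l * (\<Sum>t\<in>S. (coef y t)\<^sup>2) \<le> B y y"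
  shows "\<exists>F. finite F \<and> (\<forall>w. set w \<subseteq> S \<longrightarrow> (\<exists>v\<in>F. set v \<subseteq> S \<and> w \<doteq> v))"
proof -
  \<comment> \<open>Entries that differ by at most \<open>e\<close> give
    \<open>B d d \<le> (card S * e)\<^sup>2 \<le> l / 4\<close> for the difference \<open>d\<close>
    of two columns; the \<open>+ 1\<close> keeps the denominator positive for empty
    \<open>S\<close>.\<close>
  define e where "e = sqrt l / (2 * (real (card S) + 1))"
  have e: "e > 0" using l by (simp add: e_def)
  have ne: "real (card S) * e \<le> sqrt l / 2"
    using l by (simp add: e_def field_simps)
  define M where "M = sqrt (1 / l)"
  define N where "N = \<lceil>M / e\<rceil> + 1"
  define code where "code w = restrict (\<lambda>(s, t). \<lfloor>coef (act w (unit t)) s / e\<rfloor>) (S \<times> S)" for w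
  have "code w \<in> PiE (S \<times> S) (\<lambda>_. {-N..N})" if w: "set w \<subseteq> S" for w
  proof -
    have "-N \<le> \<lfloor>coef (act w (unit t)) s / e\<rfloor> \<and> \<lfloor>coef (act w (unit t)) s / e\<rfloor> \<le> N"
      if s: "s \<in> S" "t \<in> S" for s t
    proof -
      let ?x = "act w (unit t)"
      have "(coef ?x s)\<^sup>2 \<le> (\<Sum>t\<in>S. (coef ?x t)\<^sup>2)"
        using S s by (intro member_le_sum) auto
      also have "\<dots> \<le> 1 / l"
        using low[of ?x] w s l by (simp add: a_diag field_simps)
      finally have "\<bar>coef ?x s\<bar> \<le> M"
        unfolding M_def by (metis real_sqrt_abs real_sqrt_le_iff)
      then have "\<bar>coef ?x s / e\<bar> \<le> M / e" using e by (simp add: divide_right_mono)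
      then show ?thesis unfolding N_def by linarith
    qed
    then show ?thesis by (auto simp: code_def)
  qed
  then have "code ` {w. set w \<subseteq> S} \<subseteq> PiE (S \<times> S) (\<lambda>_. {-N..N})" by blast
  moreover have "finite (PiE (S \<times> S) (\<lambda>_. {-N..N}))"
    using S by (intro finite_PiE) auto
  ultimately have fin: "finite (code ` {w. set w \<subseteq> S})" by (rule finite_subset)
  define F where "F = inv_into {w. set w \<subseteq> S} code ` (code ` {w. set w \<subseteq> S})"
  have "\<exists>v\<in>F. set v \<subseteq> S \<and> w \<doteq> v" if w: "set w \<subseteq> S" for w
  proof -
    define v where "v = inv_into {w. set w \<subseteq> S} code (code w)"
    have vF: "v \<in> F" using w by (auto simp: F_def v_def)
    have v: "set v \<subseteq> S" "code v = code w"
      using inv_into_into[of "code w" code "{w. set w \<subseteq> S}"] f_inv_into_f[of "code w" code "{w. set w \<subseteq> S}"] w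
      by (auto simp: v_def)
    have close: "\<bar>coef (act w (unit t)) s - coef (act v (unit t)) s\<bar> \<le> e" if "s \<in> S" "t \<in> S" for s t
    proof -
      have "\<lfloor>coef (act v (unit t)) s / e\<rfloor> = \<lfloor>coef (act w (unit t)) s / e\<rfloor>"
        using fun_cong[OF v(2), of "(s, t)"] that by (simp add: code_def)
      then have "\<bar>coef (act w (unit t)) s / e - coef (act v (unit t)) s / e\<bar> \<le> 1" by linarith
      then show ?thesis using e by (simp add: diff_divide_distrib[symmetric])
    qed
    have "pos (act (rev v @ w) (unit t))" if t: "t \<in> S" for t
    proof -
      define y where "y = act (rev v @ w) (unit t) - unit t"
      define d where "d = act w (unit t) - act v (unit t)"
      have yV: "y \<in> V" and dV: "d \<in> V" using v w t by (auto simp: y_def d_def)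
      have "act v y = d" by (simp add: y_def d_def act_append)
      then have "B y y = B d d" using B_act[of v y y] by simp
      also have "\<dots> = (\<Sum>s\<in>S. \<Sum>t\<in>S. coef d s * coef d t * a s t)"
        by (rule B_superset[OF S S V_supp[OF dV] V_supp[OF dV]])
      also have "\<dots> \<le> (\<Sum>s\<in>S. \<Sum>t\<in>S. e * e)"
      proof (intro sum_mono)
        fix s t' assume "s \<in> S" "t' \<in> S"
        then have "\<bar>coef d s\<bar> \<le> e" "\<bar>coef d t'\<bar> \<le> e"
          using close t by (auto simp: d_def)
        then have "\<bar>coef d s * coef d t' * a s t'\<bar> \<le> e * e * 1"
          unfolding abs_mult using abs_a_le e by (intro mult_mono) auto
        then show "coef d s * coef d t' * a s t' \<le> e * e" by simp
      qed
      also have "\<dots> = (real (card S) * e)\<^sup>2" by (simp add: power2_eq_square)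
      also have "\<dots> \<le> (sqrt l / 2)\<^sup>2" using e ne by (intro power_mono) auto
      also have "\<dots> = l / 4" using l by (simp add: power_divide)
      finally have "l * (\<Sum>t\<in>S. (coef y t)\<^sup>2) \<le> l / 4" using low[OF yV] by simp
      then have "(\<Sum>t\<in>S. (coef y t)\<^sup>2) \<le> 1 / 4" using l by simp
      moreover have "(coef y t)\<^sup>2 \<le> (\<Sum>t\<in>S. (coef y t)\<^sup>2)"
        using S t by (intro member_le_sum) auto
      ultimately have "(coef y t)\<^sup>2 \<le> (1 / 2)\<^sup>2" by (simp add: power2_eq_square)
      then have "\<bar>coef y t\<bar> \<le> 1 / 2" by (metis abs_le_square_iff abs_of_nonneg zero_le_divide_1_iff zero_le_numeral)
      \<comment> \<open>\<open>unit t\<close> has coefficient 1 at \<open>t\<close>, so its image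
        keeps a positive coefficient there, which decides the sign of a root.\<close>
      then have "coef y t > - 1" by linarith
      then have "coef (act (rev v @ w) (unit t)) t > 0" by (simp add: y_def)
      then have "\<not> pos (- act (rev v @ w) (unit t))" by (auto simp: pos_def not_le)
      moreover have "act (rev v @ w) (unit t) \<in> roots" using v w t by (intro act_roots) auto
      ultimately show ?thesis using root_sign by blast
    qed
    then have "rev v @ w \<doteq> []" using v w by (intro faithful) auto
    then have "(v @ rev v) @ w \<doteq> v @ []" "(v @ rev v) @ w \<doteq> [] @ w"
      using eqv_append[of v v "rev v @ w" "[]"] eqv_append[of "v @ rev v" "[]" w w] eqv_rev'[of v] v w by auto
    then have "w \<doteq> v" by (auto intro: eqv_trans eqv_sym)
    with v vF show ?thesis by blast
  qed
  moreover have "finite F" using fin by (simp add: F_def)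
  ultimately show ?thesis by blast
qed

lemma pres_rel_mono:
  assumes "S' \<subseteq> S" "(u, v) \<in> pres_rel S' (coxeter_relators S' m)"
  shows "(u, v) \<in> pres_rel S (coxeter_relators S m)"
  using assms(2)
proof (induction rule: pres_rel.induct)
  case (refl w)
  then have "w \<in> words S" using assms(1) by (auto simp: words_def)
  then show ?case by (rule pres_rel.refl)
next
  case (relator r)
  then have "r \<in> coxeter_relators S m" "r \<in> words S"
    using assms(1) by (auto simp: coxeter_relators_def words_def)
  then show ?case by (rule pres_rel.relator)
qed (use assms(1) in \<open>auto intro: pres_rel.intros\<close>)

text \<open>Words in \<open>T\<close> that are equal in the Coxeter group of \<open>T\<close> are
  equal in \<open>G\<close>, so representatives for the smaller group also represent the subgroup
  generated by \<open>T\<close>; the two forms agree on vectors supported in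
  \<open>T\<close>.\<close>

lemma finite_parabolic:
  assumes T: "finite T" "T \<subseteq> S" and l: "l > 0"
    and low: "\<And>y. {s. coef y s \<noteq> 0} \<subseteq> T \<Longrightarrow> l * (\<Sum>t\<in>T. (coef y t)\<^sup>2) \<le> B y y"
  shows "finite (cls ` {w. set w \<subseteq> T})"
proof -
  interpret T: coxeter T m
    by standard (use m_sym m_diag m_off T(2) in \<open>simp add: coxeter_matrix_def subset_iff\<close>)
  have "T.B y y = B y y" if "y \<in> T.V" for y
    using T.B_superset[OF T(1) T(1) T.V_supp[OF that] T.V_supp[OF that]]
      B_superset[OF T(1) T(1) T.V_supp[OF that] T.V_supp[OF that]] T(2)
    by (auto simp: a_def T.a_def intro!: sum.cong)
  then obtain F where F: "finite F" "\<And>w. set w \<subseteq> T \<Longrightarrow> \<exists>v\<in>F. set v \<subseteq> T \<and> T.eqv w v"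
    using T.finite_if_positive_definite[OF T(1) l] low T.V_supp by metis
  have "cls ` {w. set w \<subseteq> T} \<subseteq> cls ` F"
  proof
    fix x assume "x \<in> cls ` {w. set w \<subseteq> T}"
    then obtain w where w: "set w \<subseteq> T" "x = cls w" by auto
    then obtain v where v: "v \<in> F" "set v \<subseteq> T" "T.eqv w v" using F by blast
    then have "w \<doteq> v"
      using pres_rel_mono[OF T(2)] by (simp add: eqv_def T.eqv_def R_def T.R_def emb_def T.emb_def)
    then have "cls w = cls v" using w v T(2) by (subst cls_eq_iff) auto
    then show "x \<in> cls ` F" using w v by blast
  qed
  then show ?thesis using F(1) by (meson finite_imageI finite_subset)
qed

lemma parabolic_subgroup: 
  assumes "T \<subseteq> S"
  shows "subgroup (cls ` {w. set w \<subseteq> T}) G"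
proof (rule group.subgroupI[OF group_G])
  show "cls ` {w. set w \<subseteq> T} \<subseteq> carrier G" using assms by auto
  show "cls ` {w. set w \<subseteq> T} \<noteq> {}" by (auto intro!: exI[of _ "[]"])
next
  fix x assume "x \<in> cls ` {w. set w \<subseteq> T}"
  then obtain w where w: "set w \<subseteq> T" "x = cls w" by auto
  then have "inv\<^bsub>G\<^esub> x = cls (rev w)" using assms by (simp add: inv_G)
  then show "inv\<^bsub>G\<^esub> x \<in> cls ` {w. set w \<subseteq> T}" using w by auto
next
  fix x y assume "x \<in> cls ` {w. set w \<subseteq> T}" "y \<in> cls ` {w. set w \<subseteq> T}"
  then obtain u v where "set u \<subseteq> T" "x = cls u" "set v \<subseteq> T" "y = cls v" by auto
  moreover from this have "x \<otimes>\<^bsub>G\<^esub> y = cls (u @ v)" using assms by (simp add: mult_G)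
  ultimately show "x \<otimes>\<^bsub>G\<^esub> y \<in> cls ` {w. set w \<subseteq> T}" by auto
qed

lemma eigenvector_form:
  assumes T: "finite T" "{s. coef z s \<noteq> 0} \<subseteq> T" and eig: "\<And>t. t \<in> T \<Longrightarrow> B z (unit t) = l * coef z t"
  shows "B z z = l * (\<Sum>t\<in>T. (coef z t)\<^sup>2)"
proof -
  have "B (unit t) z = l * coef z t" if "t \<in> T" for t
    using eig[OF that] by (metis B_sym)
  then show ?thesis
    using B_unit_sum[OF T, of z] by (simp add: sum_distrib_left power2_eq_square mult_ac)
qed

text \<open>Were the form semidefinite, the least eigenvalue on a finite \<open>T\<close> could not
  be 0, as its eigenvector would be a null vector and the type affine. It would be positive, every
  finite \<open>T\<close> would generate a finite subgroup, and the group would be locally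
  finite.\<close>

lemma negative_eigenvector:
  assumes na: "non_affine S m"
  obtains T z l where "finite T" "T \<subseteq> S" "{s. coef z s \<noteq> 0} \<subseteq> T" "z \<noteq> 0" "l < 0"
    "\<And>t. t \<in> T \<Longrightarrow> B z (unit t) = l * coef z t"
proof -
  have irr: "irreducible_coxeter S m" and nsph: "\<not> locally_finite_group G" and naff: "\<not> affine_type S m"
    using na by (auto simp: non_affine_def spherical_type_def)
  have "\<exists>x\<in>V. B x x < 0"
  proof (rule ccontr)
    assume "\<not> ?thesis"
    then have psd: "0 \<le> B x x" if "x \<in> V" for x using that by (meson not_less)
    have fin: "finite (cls ` {w. set w \<subseteq> T})" if T: "finite T" "T \<noteq> {}" "T \<subseteq> S" for T
    proof -
      obtain z l where z: "pos z" "z \<noteq> 0" "{s. coef z s \<noteq> 0} \<subseteq> T"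
        and low: "\<And>y. {s. coef y s \<noteq> 0} \<subseteq> T \<Longrightarrow> l * (\<Sum>t\<in>T. (coef y t)\<^sup>2) \<le> B y y"
        and eig: "\<And>t. t \<in> T \<Longrightarrow> B z (unit t) = l * coef z t"
        by (rule form_minimum[OF T]) (rule that; (assumption | blast))
      have zV: "z \<in> V" using z(3) T by (auto simp: V_def)
      have Bz: "B z z = l * (\<Sum>t\<in>T. (coef z t)\<^sup>2)"
        using T(1) z(3) eig by (rule eigenvector_form)
      obtain t where t: "coef z t \<noteq> 0" using z(2) by (metis coef_zero fvec_eqI)
      then have "0 < (\<Sum>t\<in>T. (coef z t)\<^sup>2)"
        using z(3) T(1) by (intro sum_pos2[of _ t]) auto
      with psd[OF zV] have "0 \<le> l" unfolding Bz by (simp add: zero_le_mult_iff)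
      moreover have "l \<noteq> 0"
      proof
        assume l0: "l = 0"
        have "B z (unit s) = 0" if s: "s \<in> S" for s
        proof -
          \<comment> \<open>The eigenvalue equation does not reach \<open>s\<close> outside
            \<open>T\<close>. But \<open>z\<close> is isotropic, so the form at
            \<open>z - b *\<^sub>R unit s\<close> is \<open>- b\<^sup>2\<close>, and
            semidefiniteness forces \<open>b = 0\<close>.\<close>
          define b where "b = B z (unit s)"
          have "0 \<le> B (z - b *\<^sub>R unit s) (z - b *\<^sub>R unit s)"
            using zV s by (intro psd) auto
          also have "\<dots> = - b\<^sup>2"
            using Bz l0 s by (simp add: B_sym[of "unit s"] a_diag b_def[symmetric] power2_eq_square)
          finally show ?thesis by (simp add: b_def)
        qed
        from null_vector_affine[OF irr z(1) zV z(2) this] naff show False by blast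
      qed
      ultimately show ?thesis using finite_parabolic[OF T(1,3) _ low] by simp
    qed
    have "locally_finite_group G"
      unfolding locally_finite_group_def
    proof (intro allI impI)
      fix A assume A: "A \<subseteq> carrier G \<and> finite A"
      then have "\<forall>x\<in>A. \<exists>w. set w \<subseteq> S \<and> x = cls w" by (auto simp: carrier_G)
      then obtain f where f: "\<And>x. x \<in> A \<Longrightarrow> set (f x) \<subseteq> S \<and> x = cls (f x)" by metis
      obtain s0 where s0: "s0 \<in> S" using irr by (auto simp: irreducible_coxeter_def)
      define T where "T = insert s0 (\<Union>x\<in>A. set (f x))"
      have T: "finite T" "T \<noteq> {}" "T \<subseteq> S" using A f s0 by (auto simp: T_def)
      have "A \<subseteq> cls ` {w. set w \<subseteq> T}" using f by (fastforce simp: T_def)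
      then have "generate G A \<subseteq> cls ` {w. set w \<subseteq> T}"
        by (rule group.generate_subgroup_incl[OF group_G _ parabolic_subgroup[OF T(3)]])
      then show "finite (generate G A)" using fin[OF T] by (rule finite_subset)
    qed
    with nsph show False by blast
  qed
  then obtain x where x: "x \<in> V" "B x x < 0" by auto
  define T where "T = {s. coef x s \<noteq> 0}"
  have "x \<noteq> 0" using x by auto
  then have T: "finite T" "T \<noteq> {}" "T \<subseteq> S"
    using V_supp[OF x(1)] by (auto simp: T_def) (metis coef_zero fvec_eqI)
  obtain z l where z: "pos z" "z \<noteq> 0" "{s. coef z s \<noteq> 0} \<subseteq> T"
    and low: "\<And>y. {s. coef y s \<noteq> 0} \<subseteq> T \<Longrightarrow> l * (\<Sum>t\<in>T. (coef y t)\<^sup>2) \<le> B y y"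
    and eig: "\<And>t. t \<in> T \<Longrightarrow> B z (unit t) = l * coef z t"
    by (rule form_minimum[OF T]) (rule that; (assumption | blast))
  have "l * (\<Sum>t\<in>T. (coef x t)\<^sup>2) < 0" using low[of x] x by (simp add: T_def)
  then have "l < 0" by (metis mult_nonneg_nonneg not_le sum_nonneg zero_le_power2)
  then show ?thesis using that[OF T(1,3) z(3,2) _ eig] by blast
qed

section \<open>Unbounded orbits\<close>

text \<open>If \<open>B z (w z)\<close> were bounded below, comparing \<open>w\<close> with \<open>w t\<close> for \<open>w\<close> near the infimum
  would show that all \<open>z\<^sub>t B z (w t)\<close>, hence also their sum \<open>B z (w z)\<close>, are almost nonnegative,
  while \<open>B z z < 0\<close>.\<close>

lemma eigenvector_orbit_unbounded:
  assumes T: "finite T" "T \<subseteq> S" "{s. coef z s \<noteq> 0} \<subseteq> T" and z: "z \<noteq> 0" and l: "l < 0"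
    and eig: "\<And>t. t \<in> T \<Longrightarrow> B z (unit t) = l * coef z t"
  shows "\<exists>w. set w \<subseteq> S \<and> B z (act w z) < C"
proof (rule ccontr)
  assume "\<not> ?thesis"
  then have C: "C \<le> B z (act w z)" if "set w \<subseteq> S" for w using that by (auto simp: not_less)
  define Y where "Y = (\<lambda>w. B z (act w z)) ` {w. set w \<subseteq> S}"
  have Y: "Y \<noteq> {}" "bdd_below Y"
    using C by (auto simp: Y_def bdd_below_def intro!: exI[of _ "[]"])
  have InfY: "Inf Y \<le> B z (act w z)" if "set w \<subseteq> S" for w
  proof (rule cInf_lower[OF _ Y(2)])
    show "B z (act w z) \<in> Y"
      unfolding Y_def using that by (intro image_eqI[of _ _ w]) simp_all
  qed
  have Bz: "B z z = l * (\<Sum>t\<in>T. (coef z t)\<^sup>2)"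
    using T(1,3) eig by (rule eigenvector_form)
  obtain t where t: "coef z t \<noteq> 0" using z by (metis coef_zero fvec_eqI)
  then have "0 < (\<Sum>t\<in>T. (coef z t)\<^sup>2)"
    using T by (intro sum_pos2[of _ t]) auto
  then have neg: "B z z < 0" unfolding Bz using l by (simp add: mult_less_0_iff)
  \<comment> \<open>\<open>n * \<eta>\<close> is the total error of the summands, and
    \<open>\<eta>\<close> is such that \<open>B z z + \<eta> * (n + 1) = B z z / 2\<close>, which is
    still negative.\<close>
  define n where "n = real (card T) / (- 2 * l)"
  have n: "n \<ge> 0" using l by (simp add: n_def divide_nonneg_neg)
  define \<eta> where "\<eta> = - B z z / (2 * (n + 1))"
  have \<eta>: "\<eta> > 0" using neg n by (simp add: \<eta>_def divide_neg_pos)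
  obtain w where w: "set w \<subseteq> S" "B z (act w z) < Inf Y + \<eta>"
  proof -
    have "Inf Y < Inf Y + \<eta>" using \<eta> by simp
    from cInf_lessD[OF Y(1) this] obtain y where "y \<in> Y" "y < Inf Y + \<eta>" by blast
    then show ?thesis using that unfolding Y_def by blast
  qed
  have summand: "- \<eta> / (- 2 * l) \<le> coef z t * B z (act w (unit t))" if t: "t \<in> T" for t
  proof -
    have "Inf Y \<le> B z (act (w @ [t]) z)"
      using w t T by (intro InfY) auto
    also have "\<dots> = B z (act w z) - 2 * l * (coef z t * B z (act w (unit t)))"
      using eig[OF t] by (simp add: act_append act_Cons reflect_def B_sym[of "unit t" z])
    finally have "- \<eta> \<le> - 2 * l * (coef z t * B z (act w (unit t)))"
      using w(2) by simp
    then show ?thesis using l by (simp add: field_simps)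
  qed
  have "B z (act w z) = (\<Sum>t\<in>T. coef z t * B z (act w (unit t)))"
  proof -
    have "act w z = act w (\<Sum>t\<in>T. coef z t *\<^sub>R unit t)" using fvec_expand[OF T(1,3)] by simp
    then show ?thesis by (simp add: act_sum B_sum_right)
  qed
  also have "\<dots> \<ge> (\<Sum>t\<in>T. - \<eta> / (- 2 * l))" by (intro sum_mono summand)
  finally have "- \<eta> * n \<le> B z (act w z)" by (simp add: n_def mult.commute)
  also have "\<dots> < B z z + \<eta>" using w(2) InfY[of "[]"] by simp
  finally have "0 < B z z + \<eta> * (n + 1)" by (simp add: algebra_simps)
  also have "\<eta> * (n + 1) = - B z z / 2" using n by (simp add: \<eta>_def field_simps)
  finally show False using neg by simp
qed

text \<open>Boundedness of \<open>B x (act w y)\<close> over all \<open>w\<close> is symmetric in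
  \<open>x\<close> and \<open>y\<close>, and for fixed \<open>y\<close> it defines an invariant
  subspace of vectors \<open>x\<close>. By connectedness this contains \<open>V\<close> once it
  contains a root, so boundedness would pass to the vector of
  \<open>eigenvector_orbit_unbounded\<close>.\<close>

theorem root_orbit_unbounded:
  assumes na: "non_affine S m" and d: "d \<in> roots"
  shows "\<exists>w. set w \<subseteq> S \<and> C < \<bar>B d (act w d)\<bar>"
proof (rule ccontr)
  assume "\<not> ?thesis"
  then have C: "\<bar>B d (act w d)\<bar> \<le> C" if "set w \<subseteq> S" for w using that by (auto simp: not_less)
  have irr: "irreducible_coxeter S m" using na by (simp add: non_affine_def)
  obtain u s where u: "set u \<subseteq> S" "s \<in> S" "d = act u (unit s)"
    using d by (auto simp: roots_def)
  define bd where "bd x y \<longleftrightarrow> (\<exists>C. \<forall>w. set w \<subseteq> S \<longrightarrow> \<bar>B x (act w y)\<bar> \<le> C)" for x y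
  have add: "bd (x + x') y" if "bd x y" "bd x' y" for x x' y
  proof -
    from that obtain C C' where "\<forall>w. set w \<subseteq> S \<longrightarrow> \<bar>B x (act w y)\<bar> \<le> C"
      "\<forall>w. set w \<subseteq> S \<longrightarrow> \<bar>B x' (act w y)\<bar> \<le> C'" by (auto simp: bd_def)
    then have "\<forall>w. set w \<subseteq> S \<longrightarrow> \<bar>B (x + x') (act w y)\<bar> \<le> C + C'"
      by (auto intro: order_trans[OF abs_triangle_ineq] add_mono)
    then show ?thesis unfolding bd_def by blast
  qed
  have scale: "bd (c *\<^sub>R x) y" if "bd x y" for c x y
  proof -
    from that obtain C where "\<forall>w. set w \<subseteq> S \<longrightarrow> \<bar>B x (act w y)\<bar> \<le> C" by (auto simp: bd_def)
    then have "\<forall>w. set w \<subseteq> S \<longrightarrow> \<bar>B (c *\<^sub>R x) (act w y)\<bar> \<le> \<bar>c\<bar> * C"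
      by (auto simp: abs_mult intro: mult_left_mono)
    then show ?thesis unfolding bd_def by blast
  qed
  have sym: "bd y x" if "bd x y" for x y
  proof -
    from that obtain C where C: "\<And>w. set w \<subseteq> S \<Longrightarrow> \<bar>B x (act w y)\<bar> \<le> C" by (auto simp: bd_def)
    have "\<bar>B y (act w x)\<bar> \<le> C" if "set w \<subseteq> S" for w
    proof -
      have "B y (act w x) = B x (act (rev w) y)"
        by (subst B_act_rev) (rule B_sym)
      then show ?thesis using C[of "rev w"] that by simp
    qed
    then show ?thesis unfolding bd_def by blast
  qed
  have shift: "bd (act v x) y" if "bd x y" "set v \<subseteq> S" for v x y
  proof -
    from that obtain C where C: "\<And>w. set w \<subseteq> S \<Longrightarrow> \<bar>B x (act w y)\<bar> \<le> C" by (auto simp: bd_def)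
    have "\<bar>B (act v x) (act w y)\<bar> \<le> C" if "set w \<subseteq> S" for w
      using C[of "rev v @ w"] that \<open>set v \<subseteq> S\<close> B_act_rev[of x "rev v" "act w y"]
      by (simp add: act_append)
    then show ?thesis unfolding bd_def by blast
  qed
  have zero: "bd 0 y" for y by (auto simp: bd_def)
  have all: "bd x y" if y: "bd d y" and x: "x \<in> V" for x y
  proof -
    have "bd (unit t) y" if "t \<in> S" for t
    proof (rule connected_induct[OF irr u(2) _ _ that])
      show "bd (unit s) y" using shift[OF y, of "rev u"] u by simp
      fix s t assume g: "(s, t) \<in> coxeter_graph S m" and s: "bd (unit s) y"
      note st = graph_cases[OF g]
      \<comment> \<open>The difference of \<open>unit s\<close> and its reflection in
        \<open>unit t\<close> is a multiple of \<open>unit t\<close>, nonzero since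
        \<open>a t s \<noteq> 0\<close> along an edge.\<close>
      have "bd ((- 1) *\<^sub>R act [t] (unit s) + unit s) y"
        using st s by (intro add scale shift) auto
      also have "(- 1) *\<^sub>R act [t] (unit s) + unit s = (2 * a t s) *\<^sub>R unit t"
        by (simp add: act_Cons reflect_def)
      finally have "bd ((1 / (2 * a t s)) *\<^sub>R (2 * a t s) *\<^sub>R unit t) y" by (rule scale)
      then show "bd (unit t) y" using st by (simp add: a_sym[of t s])
    qed
    with x show ?thesis by (induction x rule: V_induct) (auto intro: add scale zero)
  qed
  have "bd d d" using C by (auto simp: bd_def)
  then have "bd d x" if "x \<in> V" for x using all[OF _ that] sym by blast
  then have bd: "bd x y" if "x \<in> V" "y \<in> V" for x y using all that by blast
  obtain T z l where z: "finite T" "T \<subseteq> S" "{s. coef z s \<noteq> 0} \<subseteq> T" "z \<noteq> 0" "l < 0"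
    "\<And>t. t \<in> T \<Longrightarrow> B z (unit t) = l * coef z t"
    by (rule negative_eigenvector[OF na]) (rule that; (assumption | blast))
  then have "z \<in> V" by (auto simp: V_def)
  with bd[of z z] obtain K where K: "\<And>w. set w \<subseteq> S \<Longrightarrow> \<bar>B z (act w z)\<bar> \<le> K"
    unfolding bd_def by auto
  obtain w where "set w \<subseteq> S" "B z (act w z) < - K"
    using eigenvector_orbit_unbounded[OF z] by blast
  with K[of w] show False by simp
qed

end

section \<open>Normal subgroups\<close>

locale normal_words = coxeter S m for S :: "'s set" and m +
  fixes L :: "'s list set"
  assumes L_words: "w \<in> L \<Longrightarrow> set w \<subseteq> S"
    and L_Nil: "[] \<in> L"
    and L_append: "u \<in> L \<Longrightarrow> w \<in> L \<Longrightarrow> u @ w \<in> L"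
    and L_rev: "w \<in> L \<Longrightarrow> rev w \<in> L"
    and L_conj: "w \<in> L \<Longrightarrow> set u \<subseteq> S \<Longrightarrow> u @ w @ rev u \<in> L"
begin

lemma L_power: "w \<in> L \<Longrightarrow> concat (replicate k w) \<in> L"
  by (induction k) (auto intro: L_Nil L_append)

text \<open>With \<open>h\<close> the reflection in \<open>x\<close>, the commutator of
  \<open>n\<close> and \<open>h\<close> reads in two ways: as \<open>n\<close> times a conjugate of
  its inverse it lies in \<open>L\<close>, as a conjugate of \<open>h\<close> times \<open>h\<close>
  it is a product of two reflections.\<close>

lemma commutator_word:
  assumes x: "x \<in> roots" and n: "n \<in> L"
  obtains g where "g \<in> L" "\<And>z. act g z = reflect (act n x) (reflect x z)"
proof -
  obtain h where h: "set h \<subseteq> S" "\<And>y. act h y = reflect x y"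
    using reflect_root[OF x] by blast
  have h': "act (rev h) y = reflect x y" for y
    by (metis act_act_rev h(2) reflect_reflect B_root[OF x])
  have "n @ (h @ rev n @ rev h) \<in> L"
    by (intro L_append L_conj L_rev n h)
  moreover have "act (n @ (h @ rev n @ rev h)) z = reflect (act n x) (reflect x z)" for z
    by (simp add: act_append h h' reflect_act)
  ultimately show ?thesis by (rule that)
qed

lemma B_reflect_reflect:
  assumes "B d d = 1"
  shows "B d (reflect y (reflect x d)) = 1 - 2 * ((B x d)\<^sup>2 + (B y d)\<^sup>2 - 2 * B x d * B y d * B x y)"
  by (simp add: reflect_def assms B_sym[of d x] B_sym[of d y] B_sym[of y x] power2_eq_square algebra_simps)

text \<open>\<open>n0\<close> moves a simple root \<open>x\<close> to some
  \<open>y \<noteq> x\<close>, and the product \<open>g\<close> of the two reflections is a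
  translation for \<open>B x y > 1\<close>, unipotent for \<open>B x y = 1\<close> and a rotation
  for smaller values. In each case \<open>g\<close>, or an element derived from it, displaces some
  root far enough.\<close>

theorem flipped_root:
  assumes na: "non_affine S m" and nontriv: "n0 \<in> L" "\<not> n0 \<doteq> []"
  shows "\<exists>d\<in>roots. \<exists>n\<in>L. B d (act n d) \<le> - 1"
proof (rule ccontr)
  assume "\<not> ?thesis"
  then have H: "- 1 < B d (act n d)" if "d \<in> roots" "n \<in> L" for d n
    using that by (meson not_less)
  obtain s where s: "s \<in> S" "act n0 (unit s) \<noteq> unit s"
    using faithful[OF L_words[OF nontriv(1)]] nontriv(2) by (metis pos_unit)
  define x where "x = unit s"
  define y where "y = act n0 x"
  have x: "x \<in> roots" and y: "y \<in> roots" and xy: "x \<noteq> y"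
    using s L_words[OF nontriv(1)] by (auto simp: x_def y_def)
  have irr: "irreducible_coxeter S m" and naff: "\<not> affine_type S m"
    using na by (auto simp: non_affine_def)
  define c where "c = B x y"
  have c: "- 1 < c" unfolding c_def y_def by (rule H[OF x nontriv(1)])
  obtain g where g: "g \<in> L" "\<And>z. act g z = reflect y (reflect x z)"
    using commutator_word[OF x nontriv(1)] unfolding y_def by blast
  consider "c > 1" | "c = 1" | "c < 1" by linarith
  then show False
  proof cases
    case 1
    obtain v w \<mu> where vw: "isotropic_pair v w" "x = v + w" "v \<in> V" "w \<in> V" "\<mu> > 1"
      "\<And>z. reflect y (reflect x z) = boost v w \<mu> z"
      using hyperbolic_pair[OF x y 1[unfolded c_def]] by blast
    have gb: "act g z = boost v w \<mu> z" for z by (simp only: g(2) vw(6))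
    obtain u where u: "set u \<subseteq> S" "B v (act u (v + w)) * B w (act u (v + w)) < 0"
      using unseparated_root[OF vw(1,3,4) _ vw(5) L_words[OF g(1)] gb] x vw(2) by blast
    define d where "d = act u (v + w)"
    define q where "q = B v d * B w d"
    have q: "q < 0" using u by (simp add: q_def d_def)
    have d: "d \<in> roots" unfolding d_def vw(2)[symmetric] by (rule act_roots[OF x u(1)])
    \<comment> \<open>The product to be computed is \<open>1 + 2 * (q * (r + 1 / r - 2))\<close>
      with \<open>q < 0\<close>, which is at most \<open>-1\<close> once
      \<open>r \<ge> 2 - 1 / q\<close>.\<close>
    obtain k where k: "2 - 1 / q < \<mu> ^ k" using real_arch_pow[OF vw(5)] by blast
    define r where "r = \<mu> ^ k"
    have r: "r > 0" "2 - 1 / q < r" using k vw(5) by (auto simp: r_def)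
    have "B d (act (concat (replicate k g)) d) = B d (boost v w r d)"
      using act_power_boost[OF vw(1) _ gb] vw(5) by (simp add: r_def)
    also have "\<dots> = 1 + 2 * (q * (r + 1 / r - 2))"
      by (simp add: boost_def B_root[OF d] q_def B_sym[of d v] B_sym[of d w] algebra_simps)
    also have "\<dots> \<le> 1 + 2 * (q * (- 1 / q))"
      using r q by (intro add_left_mono mult_left_mono mult_left_mono_neg) (auto intro: order_trans[of _ "r - 2"])
    also have "\<dots> = - 1" using q by simp
    finally show False using H[OF d L_power[OF g(1), of k]] by simp
  next
    case 2
    define \<rho> where "\<rho> = y - x"
    have Bs: "B x x = 1" "B y y = 1" "B x y = 1" "B y x = 1"
      using B_root x y 2 by (auto simp: c_def B_sym)
    have step: "act g (x + t *\<^sub>R \<rho>) = x + (t + 2) *\<^sub>R \<rho>" for t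
      unfolding g \<rho>_def by (intro fvec_eqI) (simp add: reflect_def Bs algebra_simps)
    have gk: "act (concat (replicate k g)) x = x + (2 * real k) *\<^sub>R \<rho>" for k
    proof (induction k)
      case (Suc k)
      have "act (concat (replicate (Suc k) g)) x = act g (x + (2 * real k) *\<^sub>R \<rho>)"
        using Suc by (simp add: act_append del: act_add)
      then show ?case unfolding step by (simp add: algebra_simps)
    qed simp
    have root: "x + (2 * real k) *\<^sub>R \<rho> \<in> roots" for k
      using act_roots[OF x L_words[OF L_power[OF g(1)]], of k] by (simp add: gk)
    \<comment> \<open>Otherwise the reflections in \<open>x\<close> and in the far root
      \<open>x + 2 k \<rho>\<close> on the same line compose to an element that displaces a simple
      root \<open>d\<close> by an amount quadratic in \<open>k\<close>.\<close>
    have null: "B \<rho> (unit t) = 0" if t: "t \<in> S" for t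
    proof (rule ccontr)
      define d where "d = unit t"
      have d: "d \<in> roots" using t by (auto simp: d_def)
      assume "B \<rho> (unit t) \<noteq> 0"
      then obtain k where k: "1 < real k * \<bar>B \<rho> d\<bar>"
        using reals_Archimedean3[of "\<bar>B \<rho> d\<bar>"] by (auto simp: d_def)
      obtain h where h: "h \<in> L" "\<And>z. act h z = reflect (x + (2 * real k) *\<^sub>R \<rho>) (reflect x z)"
        using commutator_word[OF x L_power[OF g(1), of k]] unfolding gk by blast
      have "B x (x + (2 * real k) *\<^sub>R \<rho>) = 1" by (simp add: \<rho>_def Bs)
      then have "B d (act h d) = 1 - 8 * (real k * B \<rho> d)\<^sup>2"
        unfolding h B_reflect_reflect[OF B_root[OF d]] by (simp add: power2_eq_square algebra_simps)
      moreover have "1 < (real k * B \<rho> d)\<^sup>2"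
        using k by (metis abs_mult abs_of_nat abs_power2 one_less_power pos2 power_abs)
      ultimately show False using H[OF d h(1)] by simp
    qed
    have large: "\<exists>K. \<forall>k\<ge>K. p + 2 * real k * q < 0" if q: "q < 0" for p q :: real
    proof -
      obtain K where K: "p < real K * (- q)"
        using reals_Archimedean3[of "- q"] q by auto
      have "p + 2 * real k * q < 0" if "K \<le> k" for k
      proof -
        have "real K * (- q) \<le> real k * (- q)" "0 \<le> real k * (- q)"
          using that q by (auto intro!: mult_right_mono_neg simp: mult_nonneg_nonpos)
        then show ?thesis using K by linarith
      qed
      then show ?thesis by blast
    qed
    \<comment> \<open>Along \<open>x + 2 k \<rho>\<close> the sign of each nonzero coordinate of
      \<open>\<rho>\<close> prevails for large \<open>k\<close>; since roots have one sign, so has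
      \<open>\<rho>\<close>, as \<open>null_vector_affine\<close> requires.\<close>
    have "pos \<rho> \<or> pos (- \<rho>)"
    proof (rule ccontr)
      assume "\<not> ?thesis"
      then obtain i j where ij: "coef \<rho> i < 0" "- coef \<rho> j < 0"
        by (auto simp: pos_def not_le)
      obtain K1 where K1: "\<And>k. k \<ge> K1 \<Longrightarrow> coef x i + 2 * real k * coef \<rho> i < 0"
        using large[OF ij(1)] by blast
      obtain K2 where K2: "\<And>k. k \<ge> K2 \<Longrightarrow> - coef x j + 2 * real k * (- coef \<rho> j) < 0"
        using large[OF ij(2)] by blast
      define k where "k = max K1 K2"
      have "coef (x + (2 * real k) *\<^sub>R \<rho>) i < 0" "coef (- (x + (2 * real k) *\<^sub>R \<rho>)) j < 0"
        using K1[of k] K2[of k] by (simp_all add: k_def)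
      then have "\<not> pos (x + (2 * real k) *\<^sub>R \<rho>)" "\<not> pos (- (x + (2 * real k) *\<^sub>R \<rho>))"
        by (meson pos_def not_le)+
      with root_sign[OF root] show False by blast
    qed
    moreover have "\<rho> \<in> V" "\<rho> \<noteq> 0" using x y xy by (auto simp: \<rho>_def roots_V)
    ultimately show False
      using null_vector_affine[OF irr, of \<rho>] null_vector_affine[OF irr, of "- \<rho>"] null naff by auto
  next
    case 3
    have c2: "1 - c\<^sup>2 > 0" using c 3 by (simp add: abs_square_less_1)
    define K where "K = 1 / (1 - c\<^sup>2)"
    obtain w where w: "set w \<subseteq> S" "K + 1 < \<bar>B x (act w x)\<bar>"
      using root_orbit_unbounded[OF na x] by blast
    define d where "d = act w x"
    have d: "d \<in> roots" using x w by (auto simp: d_def)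
    define p q where "p = B x d" and "q = B y d"
    \<comment> \<open>Completing the square turns \<open>H\<close> into a bound for \<open>p\<close>
      in terms of \<open>c\<close>, while \<open>d\<close> was chosen with \<open>p\<close> beyond
      it.\<close>
    have "p\<^sup>2 * (1 - c\<^sup>2) \<le> (q - p * c)\<^sup>2 + p\<^sup>2 * (1 - c\<^sup>2)" by simp
    also have "\<dots> = p\<^sup>2 + q\<^sup>2 - 2 * p * q * c"
      by (simp add: power2_eq_square algebra_simps)
    also have "\<dots> < 1"
      using H[OF d g(1)] unfolding g B_reflect_reflect[OF B_root[OF d]] by (simp add: p_def q_def c_def)
    finally have "p\<^sup>2 * (1 - c\<^sup>2) < 1" .
    then have "p\<^sup>2 < K" using c2 by (simp add: K_def field_simps)
    moreover have p: "K + 1 < \<bar>p\<bar>" using w by (simp add: p_def d_def)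
    moreover have "K > 0" using c2 by (simp add: K_def)
    ultimately have "\<bar>p\<bar> * 1 \<le> \<bar>p\<bar> * \<bar>p\<bar>" by (intro mult_left_mono) auto
    then have "\<bar>p\<bar> \<le> p\<^sup>2" by (simp add: power2_eq_square)
    with p \<open>p\<^sup>2 < K\<close> show False by simp
  qed
qed

end

section \<open>Disjoint half-spaces and facing triples of walls\<close>

context coxeter
begin

text \<open>\<open>w\<close> runs through the whole group and stands for the inverse of a point of
  the half-spaces.\<close>

definition disjoint_sides :: "'s fvec \<Rightarrow> 's fvec \<Rightarrow> bool"
  where "disjoint_sides x y \<longleftrightarrow> (\<forall>w. set w \<subseteq> S \<longrightarrow> \<not> (pos (act w x) \<and> pos (act w y)))"

lemma disjoint_sides_sym: "disjoint_sides x y \<Longrightarrow> disjoint_sides y x"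
  by (auto simp: disjoint_sides_def)

lemma disjoint_sides_act:
  assumes "disjoint_sides x y" "set u \<subseteq> S"
  shows "disjoint_sides (act u x) (act u y)"
  unfolding disjoint_sides_def
proof (intro allI impI)
  fix w assume "set w \<subseteq> S"
  then show "\<not> (pos (act w (act u x)) \<and> pos (act w (act u y)))"
    using assms unfolding disjoint_sides_def by (auto simp flip: act_append)
qed

lemma parallel_disjoint_sides:
  assumes "x \<in> roots" "y \<in> roots" "B x y \<le> - 1"
  shows "disjoint_sides x y \<or> disjoint_sides (- x) (- y)"
  using parallel_walls[OF assms] by (auto simp: disjoint_sides_def)

lemma root_positive_somewhere:
  assumes "x \<in> roots"
  shows "\<exists>w. set w \<subseteq> S \<and> pos (act w x)"
proof (cases "pos x")
  case True
  then show ?thesis by (intro exI[of _ "[]"]) simp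
next
  case False
  then have "pos (- x)" using root_sign[OF assms] by blast
  moreover obtain w where "set w \<subseteq> S" "\<And>y. act w y = reflect x y"
    using reflect_root[OF assms] by blast
  ultimately show ?thesis by (metis B_root[OF assms] reflect_self)
qed

text \<open>The half-space of \<open>y\<close> lies in that of \<open>- x\<close>, and this one in
  that of \<open>z\<close>. Half-spaces are nonempty, so neither nested ones nor their complements
  are disjoint.\<close>

lemma mixed_sides:
  assumes x: "x \<in> roots" and y: "y \<in> roots" and z: "z \<in> roots"
    and xy: "disjoint_sides x y" and xz: "disjoint_sides (- x) (- z)"
  shows "\<not> disjoint_sides y z" "\<not> disjoint_sides (- y) (- z)"
proof -
  have sign: "pos (act w r) \<or> pos (- act w r)" if "r \<in> roots" "set w \<subseteq> S" for r w
    using root_sign act_roots that by blast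
  obtain w where w: "set w \<subseteq> S" "pos (act w y)" using root_positive_somewhere[OF y] by blast
  then have "\<not> pos (act w x)" using xy by (auto simp: disjoint_sides_def)
  then have "pos (act w z)"
    using xz sign[OF x w(1)] sign[OF z w(1)] w(1) by (auto simp: disjoint_sides_def)
  with w show "\<not> disjoint_sides y z" by (auto simp: disjoint_sides_def)
  obtain w where w: "set w \<subseteq> S" "pos (act w (- z))"
    using root_positive_somewhere[OF uminus_root[OF z]] by blast
  then have "\<not> pos (- act w x)" using xz by (auto simp: disjoint_sides_def)
  then have "pos (- act w y)"
    using xy sign[OF x w(1)] sign[OF y w(1)] w(1) by (auto simp: disjoint_sides_def)
  with w show "\<not> disjoint_sides (- y) (- z)" by (auto simp: disjoint_sides_def)
qed

text \<open>Each pair is disjoint on the positive or on the negative sides. Two pairs with different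
  choices share a root, and \<open>mixed_sides\<close> then leaves no choice for the third.\<close>

lemma facing_triple:
  assumes r: "x \<in> roots" "y \<in> roots" "z \<in> roots" and B: "B x y \<le> - 1" "B x z \<le> - 1" "B y z \<le> - 1"
  shows "(disjoint_sides x y \<and> disjoint_sides x z \<and> disjoint_sides y z) \<or>
    (disjoint_sides (- x) (- y) \<and> disjoint_sides (- x) (- z) \<and> disjoint_sides (- y) (- z))"
  using parallel_disjoint_sides[OF r(1,2) B(1)] parallel_disjoint_sides[OF r(1,3) B(2)]
    parallel_disjoint_sides[OF r(2,3) B(3)]
    mixed_sides[OF r(1,2,3)] mixed_sides[OF r(1,3,2)] mixed_sides[OF r(2,1,3)] mixed_sides[OF r(2,3,1)]
    mixed_sides[OF r(3,1,2)] mixed_sides[OF r(3,2,1)] disjoint_sides_sym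
  by metis

text \<open>Powers of a boost and of its inverse push \<open>d = v + w\<close> to nearly
  \<open>r v\<close> and \<open>r w\<close>. A third root has products of about \<open>r P\<close>
  and \<open>r Q\<close> with these, and \<open>P Q < 0\<close>; negating the second root gives both
  the same sign, which \<open>e\<close> makes negative.\<close>

lemma triple_in_orbit:
  assumes na: "non_affine S m" and d: "d \<in> roots"
  obtains u1 u2 u3 e where "set u1 \<subseteq> S" "set u2 \<subseteq> S" "set u3 \<subseteq> S" "e = 1 \<or> e = (- 1 :: real)"
    "B (act u1 d) (- act u2 d) \<le> - 1" "B (act u1 d) (e *\<^sub>R act u3 d) \<le> - 1"
    "B (- act u2 d) (e *\<^sub>R act u3 d) \<le> - 1"
proof -
  obtain y where y: "y \<in> roots" "B d y > 1"
  proof -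
    obtain w where w: "set w \<subseteq> S" "1 < \<bar>B d (act w d)\<bar>" using root_orbit_unbounded[OF na d] by blast
    have "act w d \<in> roots" "- act w d \<in> roots" using w d by (auto intro: uminus_root)
    with w(2) that show ?thesis by (cases "B d (act w d) > 0") (auto simp: abs_if split: if_splits)
  qed
  obtain v w \<mu> where vw: "isotropic_pair v w" "d = v + w" "v \<in> V" "w \<in> V" "\<mu> > 1"
    "\<And>z. reflect y (reflect d z) = boost v w \<mu> z"
    using hyperbolic_pair[OF d y] by blast
  obtain h1 h2 where h: "set h1 \<subseteq> S" "\<And>z. act h1 z = reflect y z" "set h2 \<subseteq> S" "\<And>z. act h2 z = reflect d z"
    using reflect_root[OF y(1)] reflect_root[OF d] by metis
  define g where "g = h1 @ h2"
  have g: "set g \<subseteq> S" "\<And>z. act g z = boost v w \<mu> z"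
    using h vw(6) by (auto simp: g_def act_append)
  obtain u where u: "set u \<subseteq> S" "B v (act u (v + w)) * B w (act u (v + w)) < 0"
    using unseparated_root[OF vw(1,3,4) _ vw(5) g] d vw(2) by blast
  define P Q where "P = B v (act u d)" and "Q = B w (act u d)"
  have PQ: "P * Q < 0" using u by (simp add: P_def Q_def vw(2))
  then have P0: "\<bar>P\<bar> > 0" "\<bar>Q\<bar> > 0" by auto
  \<comment> \<open>\<open>r > 2\<close> makes \<open>r * r / 2 \<ge> 1\<close>; the other bounds
    let \<open>r * \<bar>P\<bar>\<close> and \<open>r * \<bar>Q\<bar>\<close> exceed the remaining
    terms by 1.\<close>
  obtain k where k: "max 2 (max ((1 + \<bar>Q\<bar>) / \<bar>P\<bar>) ((1 + \<bar>P\<bar>) / \<bar>Q\<bar>)) < \<mu> ^ k"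
    using real_arch_pow[OF vw(5)] by blast
  define r where "r = \<mu> ^ k"
  have r: "2 < r" "1 + \<bar>Q\<bar> < r * \<bar>P\<bar>" "1 + \<bar>P\<bar> < r * \<bar>Q\<bar>"
    using k P0 by (auto simp: r_def divide_less_eq)
  have mu0: "\<mu> \<noteq> 0" using vw(5) by simp
  define u1 where "u1 = concat (replicate k g)"
  define u2 where "u2 = concat (replicate k (rev g))"
  have u12: "set u1 \<subseteq> S" "set u2 \<subseteq> S" using g by (auto simp: u1_def u2_def)
  have a1: "act u1 d = r *\<^sub>R v + (1 / r) *\<^sub>R w"
    unfolding u1_def act_power_boost[OF vw(1) mu0 g(2)] r_def[symmetric] vw(2) boost_axis[OF vw(1)] ..
  have "act (rev g) z = boost w v \<mu> z" for z
    using act_rev_boost[OF vw(1) mu0 g(2)] by (simp add: boost_swap[of w])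
  note act_power_boost[OF isotropic_pair_sym[OF vw(1)] mu0 this, of k, folded u2_def r_def]
  then have a2: "act u2 d = r *\<^sub>R w + (1 / r) *\<^sub>R v"
    unfolding vw(2) add.commute[of v] by (simp only: boost_axis[OF isotropic_pair_sym[OF vw(1)]])
  have iso: "B v v = 0" "B w w = 0" "B v w = 1 / 2" "B w v = 1 / 2"
    using vw(1) by (simp_all add: isotropic_pair_def B_sym[of w v])
  have small: "\<bar>P\<bar> / r \<le> \<bar>P\<bar>" "\<bar>Q\<bar> / r \<le> \<bar>Q\<bar>"
    using r(1) P0 by (auto simp: divide_le_eq mult_le_cancel_left1)
  have b12: "B (act u1 d) (- act u2 d) \<le> - 1"
  proof -
    have "B (act u1 d) (act u2 d) = r * r / 2 + (1 / r)\<^sup>2 / 2"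
      unfolding a1 a2 by (simp add: iso power2_eq_square)
    moreover have "2 * 2 \<le> r * r" using r(1) by (intro mult_mono) auto
    moreover have "0 \<le> (1 / r)\<^sup>2" by simp
    ultimately show ?thesis unfolding B_uminus by linarith
  qed
  have b1: "B (act u1 d) (act u d) = r * P + Q / r"
    unfolding a1 by (simp add: P_def Q_def)
  have b2: "B (act u2 d) (act u d) = r * Q + P / r"
    unfolding a2 by (simp add: P_def Q_def)
  show ?thesis
  proof (cases "P > 0")
    case True
    then have "Q < 0" using PQ by (simp add: mult_less_0_iff)
    then show ?thesis
      using True r small b12 b1 b2 by (intro that[OF u12 u(1), of "- 1"]) auto
  next
    case False
    then have "P < 0" "Q > 0" using PQ by (auto simp: mult_less_0_iff)
    then show ?thesis
      using r small b12 b1 b2 by (intro that[OF u12 u(1), of 1]) auto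
  qed
qed

section \<open>Amenable normal subgroups\<close>

lemma normal_words:
  assumes N: "N \<lhd> G"
  shows "normal_words S m {w. set w \<subseteq> S \<and> cls w \<in> N}"
proof -
  have sub: "subgroup N G" using N by (rule normal_imp_subgroup)
  show ?thesis
  proof unfold_locales
    show "[] \<in> {w. set w \<subseteq> S \<and> cls w \<in> N}"
      using subgroup.one_closed[OF sub] by (simp add: one_G)
    fix u w
    assume w: "w \<in> {w. set w \<subseteq> S \<and> cls w \<in> N}"
    then show "set w \<subseteq> S" by simp
    show "rev w \<in> {w. set w \<subseteq> S \<and> cls w \<in> N}"
      using w subgroup.m_inv_closed[OF sub, of "cls w"] by (auto simp: inv_G)
    show "u @ w \<in> {w. set w \<subseteq> S \<and> cls w \<in> N}" if "u \<in> {w. set w \<subseteq> S \<and> cls w \<in> N}"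
      using w that subgroup.m_closed[OF sub, of "cls u" "cls w"] by (auto simp: mult_G)
    show "u @ w @ rev u \<in> {w. set w \<subseteq> S \<and> cls w \<in> N}" if u: "set u \<subseteq> S"
      using normal.inv_op_closed2[OF N, of "cls u" "cls w"] u w by (auto simp: inv_G mult_G)
  qed
qed

theorem amenable_normal_trivial:
  assumes na: "non_affine S m" and N: "N \<lhd> G" and am: "amenable_group (G\<lparr>carrier := N\<rparr>)"
  shows "N = {\<one>\<^bsub>G\<^esub>}"
proof (rule ccontr)
  assume nontriv: "N \<noteq> {\<one>\<^bsub>G\<^esub>}"
  have sub: "subgroup N G" using N by (rule normal_imp_subgroup)
  define L where "L = {w. set w \<subseteq> S \<and> cls w \<in> N}"
  interpret L: normal_words S m L unfolding L_def by (rule normal_words[OF N])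
  have N_cls: "\<exists>w\<in>L. x = cls w" if "x \<in> N" for x
  proof -
    have "x \<in> cls ` {w. set w \<subseteq> S}" using that subgroup.subset[OF sub] carrier_G by blast
    then show ?thesis using that by (auto simp: L_def)
  qed
  obtain x where "x \<in> N" "x \<noteq> \<one>\<^bsub>G\<^esub>" using nontriv subgroup.one_closed[OF sub] by blast
  then obtain n0 where n0: "n0 \<in> L" "x = cls n0" using N_cls by blast
  have "\<not> n0 \<doteq> []"
  proof
    assume "n0 \<doteq> []"
    then have "cls n0 = cls []" using L.L_words[OF n0(1)] by (subst cls_eq_iff) simp_all
    with \<open>x \<noteq> \<one>\<^bsub>G\<^esub>\<close> n0 show False by (simp add: one_G)
  qed
  from L.flipped_root[OF na n0(1) this]
  obtain d n where d: "d \<in> roots" and n: "n \<in> L" and dn: "B d (act n d) \<le> - 1"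
    by (elim bexE)
  have carr: "carrier (G\<lparr>carrier := N\<rparr>) = N" by simp
  obtain \<mu> :: "'s word set set \<Rightarrow> real" where
    \<mu>: "\<forall>A. A \<subseteq> N \<longrightarrow> 0 \<le> \<mu> A" "\<mu> N = 1"
    "\<forall>A C. A \<subseteq> N \<and> C \<subseteq> N \<and> A \<inter> C = {} \<longrightarrow> \<mu> (A \<union> C) = \<mu> A + \<mu> C"
    "\<forall>g A. g \<in> N \<and> A \<subseteq> N \<longrightarrow> \<mu> (g <#\<^bsub>G\<lparr>carrier := N\<rparr>\<^esub> A) = \<mu> A"
    using am unfolding amenable_group_def carr by (elim conjE exE)
  have nonneg: "0 \<le> \<mu> A" if "A \<subseteq> N" for A using \<mu>(1) that by blast
  have add: "\<mu> (A \<union> C) = \<mu> A + \<mu> C" if "A \<subseteq> N" "C \<subseteq> N" "A \<inter> C = {}" for A C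
    using \<mu>(3) that by blast
  have inv: "\<mu> (g <#\<^bsub>G\<lparr>carrier := N\<rparr>\<^esub> A) = \<mu> A" if "g \<in> N" "A \<subseteq> N" for g A
    using \<mu>(4) that by blast
  \<comment> \<open>\<open>rev w\<close> represents the inverse, so this is the half-space of
    \<open>x\<close> cut down to \<open>N\<close>; left translations by \<open>N\<close> permute
    these sets (\<open>H_act\<close>).\<close>
  define H where "H x = cls ` {w \<in> L. pos (act (rev w) x)}" for x
  define f where "f x = \<mu> (H x)" for x
  have HN: "H x \<subseteq> N" for x by (auto simp: H_def L_def)
  have H_iff: "cls w \<in> H x \<longleftrightarrow> pos (act (rev w) x)" if w: "w \<in> L" for w x
  proof
    assume "cls w \<in> H x"
    then obtain v where v: "v \<in> L" "cls w = cls v" "pos (act (rev v) x)" by (auto simp: H_def)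
    then have "w \<doteq> v" using w L.L_words by (simp add: cls_eq_iff)
    then have "act (rev w) x = act (rev v) x"
      by (metis act_act_rev act_rev_act eqv_act)
    with v show "pos (act (rev w) x)" by simp
  qed (use w in \<open>auto simp: H_def\<close>)
  have mono: "\<mu> A \<le> 1" if "A \<subseteq> N" for A
    using add[of A "N - A"] nonneg[of "N - A"] \<mu>(2) that by (simp add: Un_absorb1)
  have f_compl: "f x + f (- x) = 1" if x: "x \<in> roots" for x
  proof -
    have "H x \<inter> H (- x) = {}"
    proof (rule ccontr)
      assume "H x \<inter> H (- x) \<noteq> {}"
      then obtain w where w: "w \<in> L" "pos (act (rev w) x)" "cls w \<in> H (- x)"
        by (auto simp: H_def)
      then have "pos (- act (rev w) x)" using H_iff[OF w(1), of "- x"] by simp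
      moreover have "act (rev w) x \<in> roots"
        using x L.L_words[OF w(1)] by (intro act_roots) auto
      ultimately show False using root_not_both w(2) by blast
    qed
    moreover have "H x \<union> H (- x) = N"
    proof
      show "N \<subseteq> H x \<union> H (- x)"
      proof
        fix y assume "y \<in> N"
        then obtain w where w: "w \<in> L" "y = cls w" using N_cls by blast
        have "act (rev w) x \<in> roots" using x L.L_words[OF w(1)] by (intro act_roots) auto
        then show "y \<in> H x \<union> H (- x)"
          using root_sign w(1) by (auto simp: H_iff w)
      qed
    qed (use HN in auto)
    ultimately show ?thesis using add[OF HN HN, of x "- x"] \<mu>(2) by (simp add: f_def)
  qed
  have H_act: "H (act v x) = cls v <#\<^bsub>G\<lparr>carrier := N\<rparr>\<^esub> H x" if v: "v \<in> L" for v x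
  proof (rule equalityI; rule subsetI)
    fix y assume "y \<in> H (act v x)"
    then obtain w where w: "w \<in> L" "y = cls w" "pos (act (rev w) (act v x))" by (auto simp: H_def)
    have vw: "rev v @ w \<in> L" by (intro L.L_append L.L_rev v w)
    have "cls (rev v @ w) \<in> H x" using w(3) by (simp add: H_iff[OF vw] act_append)
    moreover have "y = cls v \<otimes>\<^bsub>G\<^esub> cls (rev v @ w)"
    proof -
      have "(v @ rev v) @ w \<doteq> [] @ w"
        using L.L_words v w(1) by (intro eqv_append eqv_rev' eqv_refl) auto
      then show ?thesis
        using L.L_words[OF v] L.L_words[OF w(1)] w(2) by (simp add: mult_G cls_eq_iff eqv_sym)
    qed
    ultimately show "y \<in> cls v <#\<^bsub>G\<lparr>carrier := N\<rparr>\<^esub> H x" by (auto simp: l_coset_def)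
  next
    fix y assume "y \<in> cls v <#\<^bsub>G\<lparr>carrier := N\<rparr>\<^esub> H x"
    then obtain w where w: "w \<in> L" "y = cls v \<otimes>\<^bsub>G\<^esub> cls w" "pos (act (rev w) x)"
      by (auto simp: l_coset_def H_def)
    then have "y = cls (v @ w)" using L.L_words[OF v] L.L_words[OF w(1)] by (simp add: mult_G)
    then show "y \<in> H (act v x)"
      using w(3) H_iff[OF L.L_append[OF v w(1)], of "act v x"] by (simp add: act_append)
  qed
  have f_act: "f (act v x) = f x" if "v \<in> L" for v x
    unfolding f_def H_act[OF that] using that by (intro inv HN) (simp add: L_def)
  have H_disjoint: "H x \<inter> H y = {}" if "disjoint_sides x y" for x y
  proof (rule ccontr)
    assume "H x \<inter> H y \<noteq> {}"
    then obtain w where w: "w \<in> L" "pos (act (rev w) x)" "cls w \<in> H y"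
      by (auto simp: H_def)
    then have "pos (act (rev w) y)" using H_iff by simp
    with that w L.L_words[OF w(1)] show False by (auto simp: disjoint_sides_def)
  qed
  have f_disjoint: "f x + f y \<le> 1" if "disjoint_sides x y" for x y
    using add[OF HN HN H_disjoint[OF that]] mono[of "H x \<union> H y"] HN by (simp add: f_def)
  have f_disjoint3: "f x + f y + f z \<le> 1"
    if "disjoint_sides x y" "disjoint_sides x z" "disjoint_sides y z" for x y z
  proof -
    have "\<mu> ((H x \<union> H y) \<union> H z) = \<mu> (H x \<union> H y) + \<mu> (H z)"
      using that HN by (intro add) (auto simp: Int_Un_distrib2 H_disjoint)
    then show ?thesis
      using add[OF HN HN H_disjoint[OF that(1)]] mono[of "(H x \<union> H y) \<union> H z"] HN by (simp add: f_def)
  qed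
  have half: "f x = 1 / 2" if x: "x \<in> roots" and v: "v \<in> L" and B: "B x (act v x) \<le> - 1" for x v
  proof -
    obtain h where h: "set h \<subseteq> S" "\<And>y. act h y = reflect x y"
      using reflect_root[OF x] by blast
    have hx: "act h x = - x" using reflect_self[OF B_root[OF x]] by (simp add: h)
    \<comment> \<open>\<open>v'\<close> sends \<open>- x\<close> to \<open>act h (act v x)\<close>,
      so reflecting the disjoint pair gives a pair of the same shape on the other side, and
      \<open>f_act\<close> applies to it.\<close>
    define v' where "v' = h @ v @ rev h"
    have v': "v' \<in> L" unfolding v'_def by (rule L.L_conj[OF v h(1)])
    have "act (rev h) x = - x"
      using act_rev_act[of h "- x"] hx by simp
    then have v'x: "act v' x = - act h (act v x)" by (simp add: v'_def act_append)
    have vV: "act v x \<in> roots" using x L.L_words[OF v] by (rule act_roots)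
    have "disjoint_sides x (act v x) \<or> disjoint_sides (- x) (- act v x)"
      by (rule parallel_disjoint_sides[OF x vV B])
    then have "f x \<le> 1 / 2 \<and> f (- x) \<le> 1 / 2"
    proof
      assume D: "disjoint_sides x (act v x)"
      have "disjoint_sides (- x) (act v' (- x))"
        using disjoint_sides_act[OF D h(1)] by (simp add: hx v'x)
      from f_disjoint[OF D] f_disjoint[OF this] show ?thesis
        unfolding f_act[OF v] f_act[OF v'] by simp
    next
      assume D: "disjoint_sides (- x) (- act v x)"
      have "disjoint_sides x (act v' x)"
        using disjoint_sides_act[OF D h(1)] by (simp add: hx v'x)
      from f_disjoint[OF D] f_disjoint[OF this] show ?thesis
        unfolding act_uminus[symmetric] f_act[OF v] f_act[OF v'] by simp
    qed
    then show ?thesis using f_compl[OF x] by linarith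
  qed
  \<comment> \<open>Conjugation carries \<open>n\<close> along with the root, so the value holds on
    the orbit of \<open>d\<close> under the whole group, not only under \<open>N\<close>.\<close>
  have orbit: "f (act u d) = 1 / 2" "act u d \<in> roots" if u: "set u \<subseteq> S" for u
  proof -
    show r: "act u d \<in> roots" using d u by (rule act_roots)
    have "B (act u d) (act (u @ n @ rev u) (act u d)) = B d (act n d)"
      by (simp add: act_append)
    then show "f (act u d) = 1 / 2"
      using dn by (intro half[OF r L.L_conj[OF n u]]) simp
  qed
  have orbit': "f (- act u d) = 1 / 2" if u: "set u \<subseteq> S" for u
    using f_compl[OF orbit(2)[OF u]] orbit(1)[OF u] by simp
  obtain u1 u2 u3 e where u: "set u1 \<subseteq> S" "set u2 \<subseteq> S" "set u3 \<subseteq> S" "e = 1 \<or> e = (- 1 :: real)"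
    and B: "B (act u1 d) (- act u2 d) \<le> - 1" "B (act u1 d) (e *\<^sub>R act u3 d) \<le> - 1"
    "B (- act u2 d) (e *\<^sub>R act u3 d) \<le> - 1"
    using triple_in_orbit[OF na d] by metis
  have r: "- act u2 d \<in> roots" "e *\<^sub>R act u3 d \<in> roots"
    using u orbit(2) uminus_root by auto
  have f3: "f (e *\<^sub>R act u3 d) = 1 / 2" "f (- (e *\<^sub>R act u3 d)) = 1 / 2"
    using u(4) orbit(1)[OF u(3)] orbit'[OF u(3)] by auto
  show False
    using facing_triple[OF orbit(2)[OF u(1)] r B]
      f_disjoint3[of "act u1 d" "- act u2 d" "e *\<^sub>R act u3 d"]
      f_disjoint3[of "- act u1 d" "- (- act u2 d)" "- (e *\<^sub>R act u3 d)"]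
      orbit(1)[OF u(1)] orbit'[OF u(1)] orbit(1)[OF u(2)] orbit'[OF u(2)] f3
    by auto
qed

text \<open>The radical is a greatest element, so the trivial subgroup must itself qualify; its mean
  is the point mass.\<close>

lemma trivial_amenable: "amenable_group (G\<lparr>carrier := {\<one>\<^bsub>G\<^esub>}\<rparr>)"
proof -
  have "subgroup {\<one>\<^bsub>G\<^esub>} G" by (rule group.triv_subgroup[OF group_G])
  then have "group (G\<lparr>carrier := {\<one>\<^bsub>G\<^esub>}\<rparr>)"
    by (rule subgroup.subgroup_is_group[OF _ group_G])
  moreover have "\<one>\<^bsub>G\<^esub> \<otimes>\<^bsub>G\<^esub> \<one>\<^bsub>G\<^esub> = \<one>\<^bsub>G\<^esub>"
    by (simp add: one_G mult_G)
  ultimately show ?thesis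
    unfolding amenable_group_def
    by (intro conjI exI[of _ "\<lambda>A. if \<one>\<^bsub>G\<^esub> \<in> A then 1 else 0"])
      (auto simp: l_coset_def subset_singleton_iff)
qed

end

theorem corollary1:
  fixes S :: "'s set" and m :: "'s \<Rightarrow> 's \<Rightarrow> enat"
  assumes "coxeter_matrix S m"
    and "non_affine S m"
  shows "amenable_radical (coxeter_group S m) = {\<one>\<^bsub>coxeter_group S m\<^esub>}"
proof -
  interpret coxeter S m by standard (rule assms(1))
  have "{\<one>\<^bsub>G\<^esub>} \<lhd> G" by (rule group.one_is_normal[OF group_G])
  then show ?thesis
    unfolding amenable_radical_def using trivial_amenable amenable_normal_trivial[OF assms(2)]
    by (intro Greatest_equality) blast+
qed

end
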